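(* Let $[A]\in\hat V$ be a normal template with main condition set $\mathfrak{p}=\mathfrak{p}[A]$. Then for every $\vec\beta=(\beta_{rs})\in\mathcal{I}$ there exists a unique template $[T]=[T(\vec\beta)]\in\mathfrak{T}_A$ such that $T_{rs}=\beta_{rs}$ for all $(r,s)\in\mathcal{H}^{\mathbf y}$. More precisely, $\mathcal{O}^{bi}_A$ decomposes into the disjoint union of left orbits $$\mathcal{O}^{bi}_A=\bigcup_{[T]\in\mathfrak{T}_A}\mathcal{O}^l_T=\bigcup_{\vec\beta\in\mathcal{I}}\mathcal{O}^l_{T(\vec\beta)}.$$ Thus $\mathcal{I}$ parametrizes the left orbits contained in $\mathcal{O}^{bi}_A$, and $|\mathcal{I}|=q^{\iota+\upsilon}=\kappa$.
   Context: Let $n\ge1$, $q$ a prime power, $\Phi^+=\{(i,j)\mid 1\le i<j\le n\}$, and let $J\subseteq\Phi^+$ be row closed: $(i,j)\in J$ implies $(i,l)\in J$ for all $i<l\le n$. Let $E$ be the identity of $M_n(q)=M_n(\mathbb{F}_q)$, $V=\{A\in M_n(q)\mid A_{ij}\neq0\Rightarrow(i,j)\in J\}$, $U=\{u\in M_n(q)\mid u-E\in V\}$ (a group), and $\pi_J:M_n(q)\to V$ the projection setting entries outside $J$ to zero. Fix a nontrivial character $\theta:(\mathbb{F}_q,+)\to\mathbb{C}^*$. For $A\in V$ let $[A]:V\to\mathbb{C}^*$, $[A](B)=\theta\big(\sum_{(i,j)\in J}A_{ij}B_{ij}\big)$; $A\mapsto[A]$ is a bijection from $V$ onto the set $\hat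 V$ of linear characters of $(V,+)$; entries, rows, columns of $[A]$ mean those of $A$. $U$ acts on $\hat V$ from both sides by $u.[A].v=[\pi_J((u^{-1})^tA(v^{-1})^t)]$. Put $\mathcal{O}^l_A=U.[A]$, $\mathcal{O}^r_A=[A].U$, $\mathcal{O}^{bi}_A=U.[A].U$. Column $j$ and all positions in it are normal if row $j$ is not contained in $J$, i.e. $(j,l)\notin J$ for all $l>j$ (so column $n$ is normal). The hook at $(i,j)\in J$ has center $(i,j)$, arm $\{(i,k)\in J\mid i<k<j\}$ and leg $\{(k,j)\in J\mid i<k<j\}$. $[A]$ is a template if for every nonzero row $i$ with rightmost nonzero entry at $(i,j)$ one has $A_{kj}=0$ for all $i<k<j$; the positions $(i,j)$ are the main conditions, forming $\mathfrak{p}=\mathfrak{p}[A]$ (they lie in distinct rows and columns). Main hooks are the hooks centered at main conditions; main hook intersections are the positions $(a,f)$ with $(a,b),(e,f)\in\mathfrak{p}$, $e<a<f<b$. The set $\mathbf{y}=\mathbf{y}(\mathfrak{p})$ of $y$-conditions consists of the nonnormal positions on main hook arms which are not main hook intersections. A template is normal if it vanishes at all $y$-conditions. $\mathfrak{T}_A$ is the set of templates in $\mathcal{O}^{bi}_A$. Let $[A]$ be a normal template. For each $(a,b)\in\mathfrak{p}$ let $\mathcal{R}_a=\{e\mid \exists f:(e,f)\in\mathfrak{p},\ e<a<f<b\}$; $\hat{\mathcal C}_a=\{s\mid a<s<b,\ A_{es}\ne0\text{ for some }e\in\mathcal{R}_a\}$; $\mathcal{C}_a=\{s\in\hat{\mathcal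 C}_a\mid \text{column }s\text{ normal}\}$; $\mathcal{C}^{\mathfrak n}_a=\{s\in\mathcal{C}_a\mid (t,s)\in\mathfrak{p}\text{ for some }t<a\}$; $\hat\Gamma_a$ and $\Gamma_a$ the submatrices of $A$ with rows $\mathcal{R}_a$ and columns $\hat{\mathcal C}_a$, respectively $\mathcal{C}_a$. The columns of $\Gamma_a$ indexed by $\mathcal{C}^{\mathfrak n}_a$ are linearly independent. Choose $\mathcal{C}^{\mathfrak i}_a\subseteq\mathcal{C}_a\setminus\mathcal{C}^{\mathfrak n}_a$ such that the columns indexed by $\mathcal{C}^{\mathfrak n}_a\cup\mathcal{C}^{\mathfrak i}_a$ form a basis of the column space of $\Gamma_a$, and then $\hat{\mathcal C}^{\mathfrak a}_a\subseteq\hat{\mathcal C}_a\setminus\mathcal{C}_a$ such that the columns indexed by $\mathcal{C}^{\mathfrak n}_a\cup\mathcal{C}^{\mathfrak i}_a\cup\hat{\mathcal C}^{\mathfrak a}_a$ form a basis of the column space of $\hat\Gamma_a$. These choices are fixed. Let $\mathcal{H}^{\mathfrak n}$, $\mathcal{N}^{\mathfrak i}$, $\hat{\mathcal H}^{\mathfrak a}$ be the sets of all $(a,s)$ with $(a,b)\in\mathfrak{p}$ for some $b$ and $s\in\mathcal{C}^{\mathfrak n}_a$, $s\in\mathcal{C}^{\mathfrak i}_a$, $s\in\hat{\mathcal C}^{\mathfrak a}_a$, respectively. Put $\mathcal{H}^{\mathbf y}=\mathcal{H}^{\mathfrak n}\cup\mathcal{N}^{\mathfrak i}\cup\hat{\mathcal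 H}^{\mathfrak a}\cup\mathbf{y}(\mathfrak{p})$ and $$\mathcal{I}=\{\vec\beta=(\beta_{rs})\in\mathbb{F}_q^{\mathcal{H}^{\mathbf y}}\mid\beta_{rs}=0\text{ for all }(r,s)\in\mathcal{H}^{\mathfrak n}\cup\hat{\mathcal H}^{\mathfrak a}\}.$$ Finally $\iota=|\mathcal{N}^{\mathfrak i}|$, $\upsilon=|\mathbf{y}(\mathfrak{p})|$, and $\kappa=|\mathcal{O}^r_A|/|\mathcal{O}^r_A\cap\mathcal{O}^l_A|=|\mathcal{O}^l_A|/|\mathcal{O}^r_A\cap\mathcal{O}^l_A|$ is the number of left (equivalently right) orbits contained in $\mathcal{O}^{bi}_A$. *)

theory Defs
  imports "HOL-Analysis.Analysis"
begin

text \<open>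
  The field with \<open>q\<close> elements is a type \<open>'k::{field,finite}\<close>, so \<open>q = CARD('k)\<close>.  The index set
  \<open>{1, ..., n}\<close> is a type \<open>'n::{finite,linorder}\<close>, so \<open>n = CARD('n)\<close>; only the order of the
  indices is used.  Matrices are elements of \<open>'k^'n^'n\<close>, with \<open>A $ i $ j\<close> the entry in row
  \<open>i\<close> and column \<open>j\<close>.
\<close>

type_synonym ('k, 'n) sqmat = "'k^'n^'n"

section \<open>The pattern, the group and its actions\<close>

definition Phi_plus :: "('n::linorder \<times> 'n) set" where
  "Phi_plus = {(i, j). i < j}"

definition row_closed :: "('n::linorder \<times> 'n) set \<Rightarrow> bool" where
  "row_closed J \<longleftrightarrow> J \<subseteq> Phi_plus \<and> (\<forall>i j l. (i, j) \<in> J \<longrightarrow> i < l \<longrightarrow> (i, l) \<in> J)"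

definition V :: "('n::finite \<times> 'n) set \<Rightarrow> (('k::zero, 'n) sqmat) set" where
  "V J = {A. \<forall>i j. A $ i $ j \<noteq> 0 \<longrightarrow> (i, j) \<in> J}"

definition U :: "('n::finite \<times> 'n) set \<Rightarrow> (('k::ring_1, 'n) sqmat) set" where
  "U J = {u. u - mat 1 \<in> V J}"

definition proj :: "('n::finite \<times> 'n) set \<Rightarrow> ('k::zero, 'n) sqmat \<Rightarrow> ('k, 'n) sqmat" where
  "proj J A = (\<chi> i j. if (i, j) \<in> J then A $ i $ j else 0)"

definition nontrivial_character :: "('k::ab_group_add \<Rightarrow> complex) \<Rightarrow> bool" where
  "nontrivial_character \<theta> \<longleftrightarrow>
     (\<forall>x. \<theta> x \<noteq> 0) \<and> (\<forall>x y. \<theta> (x + y) = \<theta> x * \<theta> y) \<and> (\<exists>x. \<theta> x \<noteq> 1)"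

text \<open>\<open>lin_char \<theta> J A\<close> is the character \<open>[A]\<close> of \<open>(V J, +)\<close>, an extensional function on \<open>V J\<close>.\<close>

definition lin_char ::
  "('k::field \<Rightarrow> complex) \<Rightarrow> ('n::finite \<times> 'n) set \<Rightarrow> ('k, 'n) sqmat \<Rightarrow> (('k, 'n) sqmat \<Rightarrow> complex)" where
  "lin_char \<theta> J A = (\<lambda>B\<in>V J. \<theta> (\<Sum>(i, j)\<in>J. A $ i $ j * B $ i $ j))"

text \<open>
  For nontrivial \<open>\<theta>\<close> and finite \<open>'k\<close>, \<open>A \<mapsto> [A]\<close> is a bijection from \<open>V J\<close> onto the set of linear
  characters of \<open>V J\<close>.  The inverse, \<open>mat_of\<close>, supplies the entries, rows and columns of a
  character.
\<close>

definition mat_of ::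
  "('k::field \<Rightarrow> complex) \<Rightarrow> ('n::finite \<times> 'n) set \<Rightarrow> (('k, 'n) sqmat \<Rightarrow> complex) \<Rightarrow> ('k, 'n) sqmat" where
  "mat_of \<theta> J = the_inv_into (V J) (lin_char \<theta> J)"

text \<open>\<open>act \<theta> J u X v\<close> is \<open>u.X.v\<close>; the one-sided actions put \<open>mat 1\<close> on the other side.\<close>

definition act ::
  "('k::field \<Rightarrow> complex) \<Rightarrow> ('n::finite \<times> 'n) set \<Rightarrow> ('k, 'n) sqmat \<Rightarrow> (('k, 'n) sqmat \<Rightarrow> complex)
     \<Rightarrow> ('k, 'n) sqmat \<Rightarrow> (('k, 'n) sqmat \<Rightarrow> complex)" where
  "act \<theta> J u X v = lin_char \<theta> J
     (proj J (transpose (matrix_inv u) ** mat_of \<theta> J X ** transpose (matrix_inv v)))"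

definition left_orbit ::
  "('k::field \<Rightarrow> complex) \<Rightarrow> ('n::finite \<times> 'n) set \<Rightarrow> (('k, 'n) sqmat \<Rightarrow> complex)
     \<Rightarrow> (('k, 'n) sqmat \<Rightarrow> complex) set" where
  "left_orbit \<theta> J X = {act \<theta> J u X (mat 1) | u. u \<in> U J}"

definition right_orbit ::
  "('k::field \<Rightarrow> complex) \<Rightarrow> ('n::finite \<times> 'n) set \<Rightarrow> (('k, 'n) sqmat \<Rightarrow> complex)
     \<Rightarrow> (('k, 'n) sqmat \<Rightarrow> complex) set" where
  "right_orbit \<theta> J X = {act \<theta> J (mat 1) X v | v. v \<in> U J}"

definition bi_orbit ::
  "('k::field \<Rightarrow> complex) \<Rightarrow> ('n::finite \<times> 'n) set \<Rightarrow> (('k, 'n) sqmat \<Rightarrow> complex)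
     \<Rightarrow> (('k, 'n) sqmat \<Rightarrow> complex) set" where
  "bi_orbit \<theta> J X = {act \<theta> J u X v | u v. u \<in> U J \<and> v \<in> U J}"

definition left_orbits_in ::
  "('k::field \<Rightarrow> complex) \<Rightarrow> ('n::finite \<times> 'n) set \<Rightarrow> (('k, 'n) sqmat \<Rightarrow> complex) set
     \<Rightarrow> (('k, 'n) sqmat \<Rightarrow> complex) set set" where
  "left_orbits_in \<theta> J S =
     {left_orbit \<theta> J (lin_char \<theta> J B) | B. B \<in> V J \<and> left_orbit \<theta> J (lin_char \<theta> J B) \<subseteq> S}"

definition right_orbits_in ::
  "('k::field \<Rightarrow> complex) \<Rightarrow> ('n::finite \<times> 'n) set \<Rightarrow> (('k, 'n) sqmat \<Rightarrow> complex) set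
     \<Rightarrow> (('k, 'n) sqmat \<Rightarrow> complex) set set" where
  "right_orbits_in \<theta> J S =
     {right_orbit \<theta> J (lin_char \<theta> J B) | B. B \<in> V J \<and> right_orbit \<theta> J (lin_char \<theta> J B) \<subseteq> S}"

section \<open>Templates\<close>

definition normal_column :: "('n::linorder \<times> 'n) set \<Rightarrow> 'n \<Rightarrow> bool" where
  "normal_column J j \<longleftrightarrow> (\<forall>l>j. (j, l) \<notin> J)"

definition main_conditions :: "('k::zero, 'n::{finite,linorder}) sqmat \<Rightarrow> ('n \<times> 'n) set" where
  "main_conditions A = {(i, j). A $ i $ j \<noteq> 0 \<and> (\<forall>l>j. A $ i $ l = 0)}"

definition template :: "('k::zero, 'n::{finite,linorder}) sqmat \<Rightarrow> bool" where
  "template A \<longleftrightarrow>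
     (\<forall>(i, j)\<in>main_conditions A. \<forall>k. i < k \<and> k < j \<longrightarrow> A $ k $ j = 0)"

definition hook_arm :: "('n::linorder \<times> 'n) set \<Rightarrow> 'n \<Rightarrow> 'n \<Rightarrow> ('n \<times> 'n) set" where
  "hook_arm J i j = {(i, k) | k. (i, k) \<in> J \<and> i < k \<and> k < j}"

definition main_hook_intersections :: "('n::linorder \<times> 'n) set \<Rightarrow> ('n \<times> 'n) set" where
  "main_hook_intersections p =
     {(a, f) | a f. \<exists>b e. (a, b) \<in> p \<and> (e, f) \<in> p \<and> e < a \<and> a < f \<and> f < b}"

definition y_conditions :: "('n::linorder \<times> 'n) set \<Rightarrow> ('n \<times> 'n) set \<Rightarrow> ('n \<times> 'n) set" where
  "y_conditions J p =
     {(r, s) | r s. \<not> normal_column J s \<and> (\<exists>(i, j)\<in>p. (r, s) \<in> hook_arm J i j)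
        \<and> (r, s) \<notin> main_hook_intersections p}"

definition normal_template ::
  "('n::{finite,linorder} \<times> 'n) set \<Rightarrow> ('k::zero, 'n) sqmat \<Rightarrow> bool" where
  "normal_template J A \<longleftrightarrow>
     template A \<and> (\<forall>(r, s)\<in>y_conditions J (main_conditions A). A $ r $ s = 0)"

definition templates_in ::
  "('k::field \<Rightarrow> complex) \<Rightarrow> ('n::{finite,linorder} \<times> 'n) set \<Rightarrow> ('k, 'n) sqmat
     \<Rightarrow> (('k, 'n) sqmat \<Rightarrow> complex) set" where
  "templates_in \<theta> J A = {X \<in> bi_orbit \<theta> J (lin_char \<theta> J A). template (mat_of \<theta> J X)}"

section \<open>The submatrices and the choice of column bases\<close>

text \<open>In the following, \<open>(a, b)\<close> is a main condition of \<open>A\<close>.\<close>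

definition R_rows :: "('k::zero, 'n::{finite,linorder}) sqmat \<Rightarrow> 'n \<Rightarrow> 'n \<Rightarrow> 'n set" where
  "R_rows A a b = {e. \<exists>f. (e, f) \<in> main_conditions A \<and> e < a \<and> a < f \<and> f < b}"

definition C_hat :: "('k::zero, 'n::{finite,linorder}) sqmat \<Rightarrow> 'n \<Rightarrow> 'n \<Rightarrow> 'n set" where
  "C_hat A a b = {s. a < s \<and> s < b \<and> (\<exists>e\<in>R_rows A a b. A $ e $ s \<noteq> 0)}"

definition C_norm :: "('n \<times> 'n) set \<Rightarrow> ('k::zero, 'n::{finite,linorder}) sqmat \<Rightarrow> 'n \<Rightarrow> 'n \<Rightarrow> 'n set" where
  "C_norm J A a b = {s \<in> C_hat A a b. normal_column J s}"

definition C_n :: "('n \<times> 'n) set \<Rightarrow> ('k::zero, 'n::{finite,linorder}) sqmat \<Rightarrow> 'n \<Rightarrow> 'n \<Rightarrow> 'n set" where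
  "C_n J A a b = {s \<in> C_norm J A a b. \<exists>t<a. (t, s) \<in> main_conditions A}"

text \<open>
  Column \<open>s\<close> of the submatrix of \<open>A\<close> with row set \<open>R\<close>, padded with zeros outside \<open>R\<close>.  The padding
  affects neither linear independence nor spans.
\<close>

definition subcolumn :: "('k::zero, 'n::finite) sqmat \<Rightarrow> 'n set \<Rightarrow> 'n \<Rightarrow> 'k^'n" where
  "subcolumn A R s = (\<chi> e. if e \<in> R then A $ e $ s else 0)"

text \<open>
  The columns indexed by \<open>B\<close> form a basis of the column space of the submatrix of \<open>A\<close> with rows
  \<open>R\<close> and columns \<open>C\<close>.  Independence is that of the indexed family, hence \<open>inj_on\<close>.
\<close>

definition is_column_basis ::
  "('k::field, 'n::finite) sqmat \<Rightarrow> 'n set \<Rightarrow> 'n set \<Rightarrow> 'n set \<Rightarrow> bool" where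
  "is_column_basis A R C B \<longleftrightarrow>
     B \<subseteq> C \<and> inj_on (subcolumn A R) B \<and> vec.independent (subcolumn A R ` B) \<and>
     vec.span (subcolumn A R ` B) = vec.span (subcolumn A R ` C)"

text \<open>
  \<open>Ci a\<close> and \<open>Ca a\<close> are the chosen sets \<open>\<C>\<^sup>i\<^sub>a\<close> and (hatted) \<open>\<C>\<^sup>a\<^sub>a\<close>; their values matter
  only for rows \<open>a\<close> containing a main condition.
\<close>

definition admissible_choice ::
  "('n::{finite,linorder} \<times> 'n) set \<Rightarrow> ('k::field, 'n) sqmat \<Rightarrow> ('n \<Rightarrow> 'n set) \<Rightarrow> ('n \<Rightarrow> 'n set) \<Rightarrow> bool"
  where
  "admissible_choice J A Ci Ca \<longleftrightarrow>
     (\<forall>(a, b)\<in>main_conditions A.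
        Ci a \<subseteq> C_norm J A a b - C_n J A a b \<and>
        is_column_basis A (R_rows A a b) (C_norm J A a b) (C_n J A a b \<union> Ci a) \<and>
        Ca a \<subseteq> C_hat A a b - C_norm J A a b \<and>
        is_column_basis A (R_rows A a b) (C_hat A a b) (C_n J A a b \<union> Ci a \<union> Ca a))"

definition H_n :: "('n \<times> 'n) set \<Rightarrow> ('k::zero, 'n::{finite,linorder}) sqmat \<Rightarrow> ('n \<times> 'n) set" where
  "H_n J A = {(a, s) | a s. \<exists>b. (a, b) \<in> main_conditions A \<and> s \<in> C_n J A a b}"

text \<open>This covers \<open>\<N>\<^sup>i\<close> (with \<open>D = Ci\<close>) and (hatted) \<open>\<H>\<^sup>a\<close> (with \<open>D = Ca\<close>).\<close>

definition chosen_positions ::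
  "('k::zero, 'n::{finite,linorder}) sqmat \<Rightarrow> ('n \<Rightarrow> 'n set) \<Rightarrow> ('n \<times> 'n) set" where
  "chosen_positions A D = {(a, s) | a s. (\<exists>b. (a, b) \<in> main_conditions A) \<and> s \<in> D a}"

definition H_y ::
  "('n \<times> 'n) set \<Rightarrow> ('k::zero, 'n::{finite,linorder}) sqmat \<Rightarrow> ('n \<Rightarrow> 'n set) \<Rightarrow> ('n \<Rightarrow> 'n set) \<Rightarrow> ('n \<times> 'n) set"
  where
  "H_y J A Ci Ca = H_n J A \<union> chosen_positions A Ci \<union> chosen_positions A Ca
     \<union> y_conditions J (main_conditions A)"

definition I_set ::
  "('n \<times> 'n) set \<Rightarrow> ('k::zero, 'n::{finite,linorder}) sqmat \<Rightarrow> ('n \<Rightarrow> 'n set) \<Rightarrow> ('n \<Rightarrow> 'n set)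
     \<Rightarrow> ('n \<times> 'n \<Rightarrow> 'k) set" where
  "I_set J A Ci Ca =
     {\<beta> \<in> H_y J A Ci Ca \<rightarrow>\<^sub>E UNIV. \<forall>(r, s)\<in>H_n J A \<union> chosen_positions A Ca. \<beta> (r, s) = 0}"

definition matches_on ::
  "('k::field \<Rightarrow> complex) \<Rightarrow> ('n::finite \<times> 'n) set \<Rightarrow> ('n \<times> 'n) set \<Rightarrow> (('k, 'n) sqmat \<Rightarrow> complex)
     \<Rightarrow> ('n \<times> 'n \<Rightarrow> 'k) \<Rightarrow> bool" where
  "matches_on \<theta> J H X \<beta> \<longleftrightarrow> (\<forall>(r, s)\<in>H. mat_of \<theta> J X $ r $ s = \<beta> (r, s))"

text \<open>The character \<open>[T(\<beta>)]\<close>.\<close>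

definition T_of ::
  "('k::field \<Rightarrow> complex) \<Rightarrow> ('n::{finite,linorder} \<times> 'n) set \<Rightarrow> ('k, 'n) sqmat
     \<Rightarrow> ('n \<Rightarrow> 'n set) \<Rightarrow> ('n \<Rightarrow> 'n set) \<Rightarrow> ('n \<times> 'n \<Rightarrow> 'k) \<Rightarrow> (('k, 'n) sqmat \<Rightarrow> complex)" where
  "T_of \<theta> J A Ci Ca \<beta> =
     (THE X. X \<in> templates_in \<theta> J A \<and> matches_on \<theta> J (H_y J A Ci Ca) X \<beta>)"

end

theory Submission
  imports Defs
begin

text \<open>
  Passing from characters to matrices turns the left action into truncated downward row
  operations and the right action into truncated leftward column operations.  Row closedness
  enters as follows: the pattern is a union of complete rows, every row of \<open>V\<close> may be added to
  every lower row of the pattern, and a column can be changed exactly if it is nonnormal.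

  Every left orbit contains exactly one template: entries below main conditions can be cleared
  (\<open>template_in_row_orbit\<close>), and rows with distinct last columns are independent in a triangular way,
  which excludes a second template (\<open>template_unique_in_row_orbit\<close>).  So the left orbits of the
  biorbit correspond to the templates in it, and these remain to be determined.

  Let \<open>[T]\<close> be such a template.  It has the same main conditions as \<open>[A]\<close>, and row \<open>a\<close> of \<open>T\<close>
  arises from row \<open>a\<close> of \<open>A\<close> by adding only rows whose main hook crosses the main hook of row
  \<open>a\<close> (\<open>template_row_changes\<close>).  As column operations leave normal columns alone, in
  these columns \<open>T\<close> and \<open>A\<close> differ by a combination of the rows of \<open>\<Gamma>\<^sub>a\<close>, which is determined
  by its values on a column basis.  On that basis the columns from \<open>C_n\<close> carry a main condition
  above row \<open>a\<close>, so that \<open>T\<close> vanishes there, and only the columns from \<open>Ci\<close> remain.  In nonnormal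
  columns, \<open>T\<close> vanishes at the main hook intersections, and what remains are the \<open>y\<close>-conditions.
  So \<open>T\<close> is determined by its entries on \<open>Ci\<close> and on the \<open>y\<close>-conditions (\<open>template_determined\<close>).
  The set \<open>Ca\<close> gives nothing new: normality of \<open>A\<close> forces its positions to be main hook
  intersections.

  Conversely all values occur (\<open>template_with_entries\<close>): row operations realize the
  values in normal columns, and then column operations set the nonnormal entries left of the main
  conditions at will (\<open>col_orbit_all_arms\<close>).

  The number of left orbits equals the two quotients by a counting argument for commuting
  group actions (\<open>card_orbit_eq\<close>), combined with the fact that the left and the right orbit of a
  template have the same size (\<open>card_col_orbit_eq_card_row_orbit\<close>).
\<close>

section \<open>Commuting group actions\<close>

text \<open>
  Groups are given by the maps through which they act, and the axioms hold only on the carrier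
  \<open>X\<close>: the truncated row and column operations below are defined on all matrices, but the
  neutral element fixes only those supported in the pattern.
\<close>

locale transformation_group =
  fixes X :: "'x set" and G :: "('x \<Rightarrow> 'x) set"
  assumes maps_to: "g \<in> G \<Longrightarrow> x \<in> X \<Longrightarrow> g x \<in> X"
    and has_id: "\<exists>e\<in>G. \<forall>x\<in>X. e x = x"
    and has_comp: "g \<in> G \<Longrightarrow> g' \<in> G \<Longrightarrow> \<exists>k\<in>G. \<forall>x\<in>X. k x = g (g' x)"
    and has_inv: "g \<in> G \<Longrightarrow> \<exists>g'\<in>G. \<forall>x\<in>X. g' (g x) = x"

definition orbit :: "('x \<Rightarrow> 'x) set \<Rightarrow> 'x \<Rightarrow> 'x set" where
  "orbit G x = (\<lambda>g. g x) ` G"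

definition biorbit :: "('x \<Rightarrow> 'x) set \<Rightarrow> ('x \<Rightarrow> 'x) set \<Rightarrow> 'x \<Rightarrow> 'x set" where
  "biorbit G H x = {g (h x) | g h. g \<in> G \<and> h \<in> H}"

context transformation_group
begin

lemma orbit_refl: "x \<in> X \<Longrightarrow> x \<in> orbit G x"
  unfolding orbit_def image_iff using has_id by metis

lemma orbit_subset: "x \<in> X \<Longrightarrow> orbit G x \<subseteq> X"
  unfolding orbit_def using maps_to by blast

lemma orbit_trans:
  assumes "x \<in> X" "y \<in> orbit G x" shows "orbit G y \<subseteq> orbit G x"
proof
  fix z assume "z \<in> orbit G y"
  then obtain g g' where g: "g \<in> G" "g' \<in> G" "z = g (g' x)"
    using assms(2) unfolding orbit_def by blast
  then show "z \<in> orbit G x"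
    using has_comp[of g g'] assms(1) unfolding orbit_def image_iff by metis
qed

lemma orbit_sym:
  assumes "x \<in> X" "y \<in> orbit G x" shows "x \<in> orbit G y"
proof -
  obtain g where "g \<in> G" "y = g x" using assms(2) unfolding orbit_def by blast
  then show ?thesis using has_inv[of g] assms(1) unfolding orbit_def image_iff by metis
qed

lemma orbit_eq:
  assumes "x \<in> X" "y \<in> orbit G x" shows "orbit G y = orbit G x"
proof -
  have "y \<in> X" using assms orbit_subset by blast
  then show ?thesis
    using orbit_trans[of x y] orbit_trans[of y x] orbit_sym[of x y] assms by blast
qed

lemma orbit_eq_or_disjoint:
  assumes "x \<in> X" "y \<in> X" "orbit G x \<inter> orbit G y \<noteq> {}"
  shows "orbit G x = orbit G y"
proof -
  obtain z where "z \<in> orbit G x" "z \<in> orbit G y" using assms(3) by blast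
  then show ?thesis using orbit_eq[of x z] orbit_eq[of y z] assms by simp
qed

lemma inj_on_X: "g \<in> G \<Longrightarrow> inj_on g X"
  using has_inv[of g] by (metis inj_onI)

end

locale commuting_actions = L: transformation_group X G + R: transformation_group X H
  for X :: "'x set" and G H +
  assumes commute: "g \<in> G \<Longrightarrow> h \<in> H \<Longrightarrow> x \<in> X \<Longrightarrow> g (h x) = h (g x)"
begin

lemma swapped: "commuting_actions X H G"
  using commute by unfold_locales (simp add: L.maps_to R.maps_to)

lemma biorbit_swapped: "x \<in> X \<Longrightarrow> biorbit H G x = biorbit G H x"
  unfolding biorbit_def using commute by (auto; metis)

lemma biorbit_eq_Union: "biorbit G H x = (\<Union>y\<in>orbit H x. orbit G y)"
  unfolding biorbit_def orbit_def by blast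

lemma biorbit_subset: "x \<in> X \<Longrightarrow> biorbit G H x \<subseteq> X"
  unfolding biorbit_def using L.maps_to R.maps_to by blast

lemma orbits_in_biorbit:
  assumes "x \<in> X"
  shows "{orbit G y | y. y \<in> X \<and> orbit G y \<subseteq> biorbit G H x} = orbit G ` orbit H x"
proof (intro equalityI subsetI)
  fix S assume "S \<in> {orbit G y | y. y \<in> X \<and> orbit G y \<subseteq> biorbit G H x}"
  then obtain y where y: "y \<in> X" "orbit G y \<subseteq> biorbit G H x" "S = orbit G y" by blast
  then obtain z where z: "z \<in> orbit H x" "y \<in> orbit G z"
    using L.orbit_refl biorbit_eq_Union by blast
  then have "S = orbit G z" using y L.orbit_eq[of z y] R.orbit_subset[OF assms] by blast
  then show "S \<in> orbit G ` orbit H x" using z by blast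
next
  fix S assume "S \<in> orbit G ` orbit H x"
  then obtain z where z: "z \<in> orbit H x" "S = orbit G z" by blast
  then show "S \<in> {orbit G y | y. y \<in> X \<and> orbit G y \<subseteq> biorbit G H x}"
    using R.orbit_subset[OF assms] biorbit_eq_Union by blast
qed

lemma map_orbit:
  assumes "x \<in> X" "h \<in> H" shows "h ` orbit G x = orbit G (h x)"
  unfolding orbit_def image_image using assms by (intro image_cong refl commute[symmetric])

lemma card_orbit_inter_orbit:
  assumes "x \<in> X" "y \<in> orbit H x"
  shows "card (orbit H x \<inter> orbit G y) = card (orbit H x \<inter> orbit G x)"
proof -
  obtain h where h: "h \<in> H" "y = h x" using assms unfolding orbit_def by blast
  have inj: "inj_on h X" by (rule R.inj_on_X[OF h(1)])
  have "h ` orbit H x = orbit H x"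
  proof
    show "h ` orbit H x \<subseteq> orbit H x"
    proof
      fix z assume "z \<in> h ` orbit H x"
      then obtain w where w: "w \<in> orbit H x" "z = h w" by blast
      then have "z \<in> orbit H w" using h unfolding orbit_def by blast
      then show "z \<in> orbit H x" using R.orbit_eq[OF assms(1) w(1)] by simp
    qed
    show "orbit H x \<subseteq> h ` orbit H x"
    proof
      fix z assume z: "z \<in> orbit H x"
      obtain h' where h': "h' \<in> H" "\<forall>x\<in>X. h' (h x) = x" using R.has_inv[OF h(1)] by blast
      have zX: "z \<in> X" using z R.orbit_subset[OF assms(1)] by blast
      have "h' z \<in> orbit H z" using h' unfolding orbit_def by blast
      then have z': "h' z \<in> orbit H x" using R.orbit_eq[OF assms(1) z] by simp
      obtain h'' where h'': "h'' \<in> H" "\<forall>x\<in>X. h'' (h' x) = x" using R.has_inv[OF h'(1)] by blast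
      have "h (h' z) \<in> X" "h' z \<in> X" using zX h' h R.maps_to by auto
      then have "h (h' z) = h'' (h' (h (h' z)))" using h'' by simp
      also have "\<dots> = h'' (h' z)" using h' \<open>h' z \<in> X\<close> by simp
      finally have "h (h' z) = z" using h'' zX by simp
      then show "z \<in> h ` orbit H x" using z' by (metis image_eqI)
    qed
  qed
  then have "orbit H x \<inter> orbit G y = h ` (orbit H x \<inter> orbit G x)"
    using inj_on_image_Int[OF inj R.orbit_subset L.orbit_subset, of x x] assms(1)
      map_orbit[OF assms(1) h(1)] h(2) by simp
  moreover have "inj_on h (orbit H x \<inter> orbit G x)"
    using inj inj_on_subset[of h X] R.orbit_subset[OF assms(1)] by blast
  ultimately show ?thesis by (simp add: card_image)
qed

text \<open>
  Every \<open>G\<close>-orbit inside the biorbit of \<open>x\<close> meets the \<open>H\<close>-orbit of \<open>x\<close>, because \<open>H\<close> permutes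
  these \<open>G\<close>-orbits transitively; for the same reason all the intersections have the same size.
  So the \<open>H\<close>-orbit is cut into equal pieces, one for each \<open>G\<close>-orbit.
\<close>

lemma card_orbit_eq:
  assumes "x \<in> X" "finite X"
  shows "card (orbit H x) = card (orbit G ` orbit H x) * card (orbit H x \<inter> orbit G x)"
proof -
  have fin: "finite (orbit H x)" using assms R.orbit_subset finite_subset by blast
  have un: "orbit H x = (\<Union>S\<in>orbit G ` orbit H x. orbit H x \<inter> S)"
    using R.orbit_subset[OF assms(1)] L.orbit_refl by blast
  have "card (\<Union>S\<in>orbit G ` orbit H x. orbit H x \<inter> S)
      = (\<Sum>S\<in>orbit G ` orbit H x. card (orbit H x \<inter> S))"
  proof (rule card_UN_disjoint)
    show "\<forall>S\<in>orbit G ` orbit H x. \<forall>S'\<in>orbit G ` orbit H x.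
        S \<noteq> S' \<longrightarrow> (orbit H x \<inter> S) \<inter> (orbit H x \<inter> S') = {}"
      using L.orbit_eq_or_disjoint R.orbit_subset[OF assms(1)] by blast
  qed (use fin in auto)
  also have "\<dots> = (\<Sum>S\<in>orbit G ` orbit H x. card (orbit H x \<inter> orbit G x))"
    by (rule sum.cong) (use card_orbit_inter_orbit[OF assms(1)] in auto)
  finally show ?thesis using un by simp
qed

end

section \<open>Rows with distinct last columns\<close>

text \<open>
  Ordered by last column, the rows form a triangular system with nonzero diagonal.  In the
  induction on the row \<open>m\<close> with the largest last column, the unknown at \<open>b m\<close> is free, since all
  other rows vanish there.
\<close>

lemma distinct_last_columns_solvable:
  fixes B :: "'i \<Rightarrow> 'n::{finite,linorder} \<Rightarrow> 'k::field"
  assumes "finite I" "\<And>i. i \<in> I \<Longrightarrow> B i (b i) \<noteq> 0" "\<And>i l. i \<in> I \<Longrightarrow> b i < l \<Longrightarrow> B i l = 0"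
    and "inj_on b I"
  shows "\<exists>z. (\<forall>l. z l \<noteq> 0 \<longrightarrow> l \<in> b ` I) \<and> (\<forall>i\<in>I. (\<Sum>l\<in>UNIV. B i l * z l) = x i)"
  using assms
proof (induction I rule: finite_ranking_induct[where f = b])
  case empty
  show ?case by (rule exI[of _ "\<lambda>_. 0"]) simp
next
  case (insert m I)
  show ?case
  proof (cases "m \<in> I")
    case True
    then show ?thesis using insert by (simp add: insert_absorb)
  next
    case False
    obtain z where z: "\<And>l. z l \<noteq> 0 \<Longrightarrow> l \<in> b ` I" "\<And>i. i \<in> I \<Longrightarrow> (\<Sum>l\<in>UNIV. B i l * z l) = x i"
      using insert.IH insert.prems by (simp add: inj_on_insert) blast
    define c where "c = (x m - (\<Sum>l\<in>UNIV. B m l * z l)) / B m (b m)"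
    define z' where "z' l = z l + (if l = b m then c else 0)" for l
    have "B i l * z' l = B i l * z l + (if l = b m then B i (b m) * c else 0)" for i l
      by (simp add: z'_def distrib_left)
    then have sum: "(\<Sum>l\<in>UNIV. B i l * z' l) = (\<Sum>l\<in>UNIV. B i l * z l) + B i (b m) * c" for i
      by (simp add: sum.distrib)
    show ?thesis
    proof (intro exI[of _ z'] conjI allI impI ballI)
      fix l assume "z' l \<noteq> 0"
      then show "l \<in> b ` insert m I" using z(1)[of l] by (auto simp: z'_def split: if_splits)
    next
      fix i assume i: "i \<in> insert m I"
      show "(\<Sum>l\<in>UNIV. B i l * z' l) = x i"
      proof (cases "i = m")
        case True
        then show ?thesis using sum[of m] insert.prems(1)[of m] by (simp add: c_def)
      next
        case ne: False
        then have iI: "i \<in> I" using i by blast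
        have "b i < b m"
          using insert.hyps(2)[OF iI] insert.prems(3) iI ne False
          by (metis i inj_on_def insertI1 order_le_less)
        then have "B i (b m) = 0" using insert.prems(2) i by blast
        then show ?thesis using sum[of i] z(2)[OF iI] by simp
      qed
    qed
  qed
qed

text \<open>
  Among the rows with nonzero coefficient, let \<open>i\<close> be the one whose last column is furthest to
  the right.  At that column no other row contributes, so nothing can cancel.  Almost every
  independence argument below is an instance of this.
\<close>

lemma last_column_of_combination:
  fixes B :: "'i \<Rightarrow> 'n::linorder \<Rightarrow> 'k::field"
  assumes "finite I" "\<And>i l. i \<in> I \<Longrightarrow> b i < l \<Longrightarrow> B i l = 0" "inj_on b I"
    and "i1 \<in> I" "w i1 \<noteq> 0"
  obtains i where "i \<in> I" "w i \<noteq> 0" "(\<Sum>i'\<in>I. w i' * B i' (b i)) = w i * B i (b i)"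
    "\<forall>i'\<in>I. w i' \<noteq> 0 \<longrightarrow> b i' \<le> b i"
proof -
  let ?N = "{i \<in> I. w i \<noteq> 0}"
  have "finite (b ` ?N)" "b ` ?N \<noteq> {}" using assms by auto
  then have "Max (b ` ?N) \<in> b ` ?N" "\<forall>j\<in>b ` ?N. j \<le> Max (b ` ?N)" by auto
  then obtain i where i: "i \<in> I" "w i \<noteq> 0" "\<And>i'. i' \<in> I \<Longrightarrow> w i' \<noteq> 0 \<Longrightarrow> b i' \<le> b i" by fastforce
  have "(\<Sum>i'\<in>I. w i' * B i' (b i)) = w i * B i (b i) + (\<Sum>i'\<in>I - {i}. w i' * B i' (b i))"
    using i(1) assms(1) by (simp add: sum.remove)
  also have "(\<Sum>i'\<in>I - {i}. w i' * B i' (b i)) = 0"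
  proof (rule sum.neutral, rule ballI)
    fix i' assume i': "i' \<in> I - {i}"
    show "w i' * B i' (b i) = 0"
    proof (cases "w i' = 0")
      case False
      then have "b i' < b i" using i(3)[of i'] i' i(1) assms(3)
        by (metis DiffD1 DiffD2 inj_on_def order_le_less singletonI)
      then show ?thesis using assms(2) i' by simp
    qed simp
  qed
  finally show ?thesis using that i by simp
qed

text \<open>
  The index type is only finite and linearly ordered, so the induction rule of the class
  \<open>wellorder\<close> does not apply to it.
\<close>

lemma finite_linorder_less_induct:
  fixes a :: "'n::{finite,linorder}"
  assumes "\<And>a. (\<And>i. i < a \<Longrightarrow> P i) \<Longrightarrow> P a"
  shows "P a"
proof (induction "card {..<a}" arbitrary: a rule: less_induct)
  case less
  show ?case
  proof (rule assms)
    fix i assume "i < a"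
    then have "card {..<i} < card {..<a}" by (intro psubset_card_mono) auto
    then show "P i" by (rule less)
  qed
qed

section \<open>The pattern group and its two actions on matrices\<close>

lemma V_entry: "A \<in> V J \<Longrightarrow> A $ i $ j \<noteq> 0 \<Longrightarrow> (i, j) \<in> J"
  by (simp add: V_def)

lemma proj_in_V [simp]: "proj J B \<in> V J"
  by (auto simp: proj_def V_def split: if_splits)

lemma proj_entry: "proj J B $ i $ j = (if (i, j) \<in> J then B $ i $ j else 0)"
  by (simp add: proj_def)

lemma proj_V: "B \<in> V J \<Longrightarrow> proj J B = B"
  by (auto simp: vec_eq_iff proj_entry V_def)

lemma U_iff:
  fixes u :: "('k::field, 'n::finite) sqmat"
  shows "u \<in> U J \<longleftrightarrow> (\<forall>i j. (i, j) \<notin> J \<longrightarrow> u $ i $ j = (if i = j then 1 else 0))"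
  by (auto simp: U_def V_def mat_def)

lemma one_in_U [simp]: "(mat 1 :: ('k::field, 'n::finite) sqmat) \<in> U J"
  by (simp add: U_iff mat_def)

text \<open>
  The two-sided action on characters, with the inverses absorbed into the group element.
  \<open>row_act J u\<close> adds \<open>u $ i $ k\<close> times row \<open>i\<close> to each lower row \<open>k > i\<close>, and \<open>col_act J v\<close> adds
  \<open>v $ j $ l\<close> times column \<open>l\<close> to each column \<open>j < l\<close> further left; both cut the result back to
  the pattern.
\<close>

definition row_act ::
  "('n::finite \<times> 'n) set \<Rightarrow> ('k::field, 'n) sqmat \<Rightarrow> ('k, 'n) sqmat \<Rightarrow> ('k, 'n) sqmat" where
  "row_act J u B = proj J (transpose u ** B)"

definition col_act ::
  "('n::finite \<times> 'n) set \<Rightarrow> ('k::field, 'n) sqmat \<Rightarrow> ('k, 'n) sqmat \<Rightarrow> ('k, 'n) sqmat" where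
  "col_act J v B = proj J (B ** transpose v)"

lemma act_in_V [simp]: "row_act J u B \<in> V J" "col_act J v B \<in> V J"
  by (simp_all add: row_act_def col_act_def)

text \<open>
  A row closed pattern consists of complete rows \<open>{(i, l) | l > i}\<close>.  Hence \<open>j\<close> is a nonnormal
  column exactly if row \<open>j\<close> of the pattern is nonempty, and then it is the whole row.
\<close>

locale row_closed_pattern =
  fixes J :: "('n::{finite,linorder} \<times> 'n) set"
  assumes row_closed: "row_closed J"
begin

lemma J_less: "(i, j) \<in> J \<Longrightarrow> i < j"
  using row_closed by (auto simp: row_closed_def Phi_plus_def)

lemma J_row: "(i, j) \<in> J \<Longrightarrow> i < l \<Longrightarrow> (i, l) \<in> J"
  using row_closed unfolding row_closed_def by blast

lemma not_normal: "(j, l) \<in> J \<Longrightarrow> \<not> normal_column J j"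
  using J_less by (auto simp: normal_column_def)

lemma J_if_not_normal: "\<not> normal_column J j \<Longrightarrow> j < l \<Longrightarrow> (j, l) \<in> J"
  using J_row by (auto simp: normal_column_def)

lemma U_diag: "(u :: ('k::field, 'n) sqmat) \<in> U J \<Longrightarrow> u $ i $ i = 1"
  using J_less[of i i] unfolding U_iff by (metis less_irrefl)

lemma U_offdiag: "(u :: ('k::field, 'n) sqmat) \<in> U J \<Longrightarrow> i \<noteq> j \<Longrightarrow> u $ i $ j \<noteq> 0 \<Longrightarrow> (i, j) \<in> J"
  unfolding U_iff by metis

lemma U_nonzero: "(u :: ('k::field, 'n) sqmat) \<in> U J \<Longrightarrow> u $ i $ j \<noteq> 0 \<Longrightarrow> i = j \<or> (i, j) \<in> J"
  using U_offdiag by blast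

lemma U_lower: "(u :: ('k::field, 'n) sqmat) \<in> U J \<Longrightarrow> j < i \<Longrightarrow> u $ i $ j = 0"
  using U_offdiag[of u i j] J_less[of i j] by force

lemma U_mult:
  fixes u v :: "('k::field, 'n) sqmat"
  assumes "u \<in> U J" "v \<in> U J" shows "u ** v \<in> U J"
  unfolding U_iff
proof (intro allI impI)
  fix i j assume ij: "(i, j) \<notin> J"
  have "(u ** v) $ i $ j = (\<Sum>k\<in>UNIV. u $ i $ k * v $ k $ j)"
    by (simp add: matrix_matrix_mult_def)
  also have "\<dots> = (\<Sum>k\<in>UNIV. if k = i then v $ i $ j else 0)"
  proof (rule sum.cong[OF refl])
    fix k
    show "u $ i $ k * v $ k $ j = (if k = i then v $ i $ j else 0)"
    proof (cases "k = i")
      case True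
      then show ?thesis using U_diag[OF assms(1), of i] by simp
    next
      case False
      have "u $ i $ k = 0 \<or> v $ k $ j = 0"
      proof (rule ccontr)
        assume "\<not> ?thesis"
        then have "(i, k) \<in> J" "k = j \<or> (k, j) \<in> J"
          using U_offdiag[OF assms(1), of i k] U_nonzero[OF assms(2), of k j] False by auto
        then show False using ij J_row[of i k j] J_less[of i k] J_less[of k j] by force
      qed
      then show ?thesis using False by auto
    qed
  qed
  also have "\<dots> = (if i = j then 1 else 0)" using ij assms(2) by (simp add: U_iff)
  finally show "(u ** v) $ i $ j = (if i = j then 1 else 0)" .
qed

text \<open>
  \<open>U J\<close> is finite and closed under products, so it suffices that left multiplication by \<open>u\<close> is
  injective.  This is seen in the lowest row where two matrices differ: there a unitriangular \<open>u\<close>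
  adds only multiples of rows in which they agree.
\<close>

lemma U_inverse:
  fixes u :: "('k::{field,finite}, 'n) sqmat"
  assumes u: "u \<in> U J"
  obtains v where "v \<in> U J" "u ** v = mat 1" "v ** u = mat 1"
proof -
  have "inj_on ((**) u) (U J)"
  proof (rule inj_onI, rule ccontr)
    fix v v' :: "('k, 'n) sqmat" assume eq: "u ** v = u ** v'" and "v \<noteq> v'"
    then obtain i j where "v $ i $ j \<noteq> v' $ i $ j" by (auto simp: vec_eq_iff)
    define S where "S = {i. v $ i $ j \<noteq> v' $ i $ j}"
    have "S \<noteq> {}" using \<open>v $ i $ j \<noteq> v' $ i $ j\<close> S_def by blast
    define m where "m = Max S"
    have mS: "m \<in> S" and mmax: "\<And>k. k \<in> S \<Longrightarrow> k \<le> m"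
      using \<open>S \<noteq> {}\<close> by (simp_all add: m_def)
    have um: "(u ** w) $ m $ j = w $ m $ j + (\<Sum>k\<in>{m<..}. u $ m $ k * w $ k $ j)"
      for w :: "('k, 'n) sqmat"
    proof -
      have "(u ** w) $ m $ j = (\<Sum>k\<in>UNIV. u $ m $ k * w $ k $ j)"
        by (simp add: matrix_matrix_mult_def)
      also have "\<dots> = (\<Sum>k\<in>insert m {m<..}. u $ m $ k * w $ k $ j)"
        by (rule sum.mono_neutral_right) (auto simp: not_less order_le_less U_lower[OF u])
      finally show ?thesis by (simp add: U_diag[OF u])
    qed
    have "(\<Sum>k\<in>{m<..}. u $ m $ k * v $ k $ j) = (\<Sum>k\<in>{m<..}. u $ m $ k * v' $ k $ j)"
    proof (rule sum.cong[OF refl])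
      fix k assume "k \<in> {m<..}"
      then have "v $ k $ j = v' $ k $ j" using mmax[of k] unfolding S_def by force
      then show "u $ m $ k * v $ k $ j = u $ m $ k * v' $ k $ j" by simp
    qed
    then have "v $ m $ j = v' $ m $ j" using um[of v] um[of v'] eq by simp
    then show False using mS S_def by blast
  qed
  moreover have "(**) u ` U J \<subseteq> U J" using U_mult u by blast
  ultimately have surj: "(**) u ` U J = U J" by (intro endo_inj_surj) auto
  have "mat 1 \<in> (**) u ` U J" unfolding surj by (rule one_in_U)
  then obtain v where v: "mat 1 = u ** v" "v \<in> U J" by (rule imageE)
  then show ?thesis using that[of v] matrix_left_right_inverse[of u v] by simp
qed

lemma matrix_inv_U:
  fixes u :: "('k::{field,finite}, 'n) sqmat"
  assumes "u \<in> U J"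
  shows "matrix_inv u \<in> U J" "matrix_inv (matrix_inv u) = u"
proof -
  have inv: "matrix_inv x = y" if "x ** y = mat 1" "y ** x = mat 1" for x y :: "('k, 'n) sqmat"
  proof -
    have "\<exists>x'. x ** x' = mat 1 \<and> x' ** x = mat 1" using that by blast
    then have "matrix_inv x ** x = mat 1"
      unfolding matrix_inv_def by (rule someI2_ex) blast
    then have "matrix_inv x ** (x ** y) = y" by (simp add: matrix_mul_assoc)
    then show ?thesis using that by simp
  qed
  obtain v where "v \<in> U J" "u ** v = mat 1" "v ** u = mat 1" using U_inverse[OF assms] .
  then show "matrix_inv u \<in> U J" "matrix_inv (matrix_inv u) = u" using inv by auto
qed

lemma row_act_entry:
  fixes u :: "('k::field, 'n) sqmat"
  assumes "u \<in> U J"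
  shows "row_act J u B $ k $ j =
    (if (k, j) \<in> J then B $ k $ j + (\<Sum>i\<in>{..<k}. u $ i $ k * B $ i $ j) else 0)"
proof -
  have "(transpose u ** B) $ k $ j = (\<Sum>i\<in>UNIV. u $ i $ k * B $ i $ j)"
    by (simp add: matrix_matrix_mult_def transpose_def)
  also have "\<dots> = (\<Sum>i\<in>insert k {..<k}. u $ i $ k * B $ i $ j)"
    by (rule sum.mono_neutral_right) (auto simp: not_less order_le_less U_lower[OF assms])
  finally show ?thesis by (simp add: row_act_def proj_entry U_diag[OF assms])
qed

lemma col_act_entry:
  fixes v :: "('k::field, 'n) sqmat"
  assumes "v \<in> U J"
  shows "col_act J v B $ i $ j =
    (if (i, j) \<in> J then B $ i $ j + (\<Sum>l\<in>{j<..}. B $ i $ l * v $ j $ l) else 0)"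
proof -
  have "(B ** transpose v) $ i $ j = (\<Sum>l\<in>UNIV. B $ i $ l * v $ j $ l)"
    by (simp add: matrix_matrix_mult_def transpose_def)
  also have "\<dots> = (\<Sum>l\<in>insert j {j<..}. B $ i $ l * v $ j $ l)"
    by (rule sum.mono_neutral_right) (auto simp: not_less order_le_less U_lower[OF assms])
  finally show ?thesis by (simp add: col_act_def proj_entry U_diag[OF assms])
qed

text \<open>
  Entries outside the pattern never reach it: by row closedness, if \<open>(i, k)\<close> and \<open>(k, j)\<close> lie in
  \<open>J\<close> then so does \<open>(i, j)\<close>.  This makes the truncated operations a group action.
\<close>

lemma row_act_proj:
  fixes u :: "('k::field, 'n) sqmat"
  assumes "u \<in> U J" shows "row_act J u (proj J B) = row_act J u B"
proof -
  have "u $ i $ k * proj J B $ i $ j = u $ i $ k * B $ i $ j" if "(k, j) \<in> J" "i < k" for i j k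
    using U_offdiag[OF assms, of i k] J_row[of i k j] J_less[OF that(1)] that(2)
    by (cases "u $ i $ k = 0") (auto simp: proj_entry)
  then show ?thesis
    unfolding vec_eq_iff row_act_entry[OF assms]
    by (intro allI if_cong refl arg_cong2[where f = "(+)"] sum.cong) (auto simp: proj_entry)
qed

lemma col_act_proj:
  fixes v :: "('k::field, 'n) sqmat"
  assumes "v \<in> U J" shows "col_act J v (proj J B) = col_act J v B"
proof -
  have "proj J B $ i $ l * v $ j $ l = B $ i $ l * v $ j $ l" if "(i, j) \<in> J" "j < l" for i j l
    using J_row[OF that(1), of l] J_less[OF that(1)] that(2) by (simp add: proj_entry)
  then show ?thesis
    unfolding vec_eq_iff col_act_entry[OF assms]
    by (intro allI if_cong refl arg_cong2[where f = "(+)"] sum.cong) (auto simp: proj_entry)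
qed

lemma row_act_row_act:
  fixes u :: "('k::field, 'n) sqmat"
  assumes "u \<in> U J" shows "row_act J u (row_act J u' B) = row_act J (u' ** u) B"
  unfolding row_act_def[of J u' B] row_act_proj[OF assms]
  by (simp add: row_act_def matrix_transpose_mul matrix_mul_assoc)

lemma col_act_col_act:
  fixes v :: "('k::field, 'n) sqmat"
  assumes "v \<in> U J" shows "col_act J v (col_act J v' B) = col_act J (v ** v') B"
  unfolding col_act_def[of J v' B] col_act_proj[OF assms]
  by (simp add: col_act_def matrix_transpose_mul matrix_mul_assoc)

lemma row_act_col_act:
  fixes u v :: "('k::field, 'n) sqmat"
  assumes "u \<in> U J" "v \<in> U J"
  shows "row_act J u (col_act J v B) = col_act J v (row_act J u B)"
  unfolding col_act_def[of J v B] row_act_def[of J u B] row_act_proj[OF assms(1)] col_act_proj[OF assms(2)]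
  by (simp add: col_act_def row_act_def matrix_mul_assoc)

lemma act_one: "B \<in> V J \<Longrightarrow> row_act J (mat 1) B = B" "B \<in> V J \<Longrightarrow> col_act J (mat 1) B = B"
  by (simp_all add: row_act_def col_act_def proj_V transpose_mat)

lemma transformation_group_row_act:
  "transformation_group (V J :: ('k::{field,finite}, 'n) sqmat set) (row_act J ` U J)"
proof (rule transformation_group.intro)
  fix g :: "('k, 'n) sqmat \<Rightarrow> ('k, 'n) sqmat" and x
  assume "g \<in> row_act J ` U J"
  then obtain u where u: "u \<in> U J" "g = row_act J u" by blast
  show "g x \<in> V J" using u by simp
  obtain v where "v \<in> U J" "u ** v = mat 1" using U_inverse[OF u(1)] .
  then have "row_act J v \<in> row_act J ` U J" "\<forall>x\<in>V J. row_act J v (g x) = x"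
    by (simp_all add: u(2) row_act_row_act act_one)
  then show "\<exists>g'\<in>row_act J ` U J. \<forall>x\<in>V J. g' (g x) = x" by blast
  fix g' :: "('k, 'n) sqmat \<Rightarrow> ('k, 'n) sqmat"
  assume "g' \<in> row_act J ` U J"
  then obtain u' where u': "u' \<in> U J" "g' = row_act J u'" by blast
  have "row_act J (u' ** u) \<in> row_act J ` U J" using U_mult[OF u'(1) u(1)] by (rule imageI)
  moreover have "\<forall>x\<in>V J. row_act J (u' ** u) x = g (g' x)"
    by (simp add: u u' row_act_row_act)
  ultimately show "\<exists>k\<in>row_act J ` U J. \<forall>x\<in>V J. k x = g (g' x)" by blast
next
  have "row_act J (mat 1) \<in> row_act J ` (U J :: ('k, 'n) sqmat set)"
    using one_in_U by (rule imageI)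
  then show "\<exists>e\<in>row_act J ` U J. \<forall>x\<in>V J. e x = (x :: ('k, 'n) sqmat)"
    using act_one(1) by blast
qed

lemma transformation_group_col_act:
  "transformation_group (V J :: ('k::{field,finite}, 'n) sqmat set) (col_act J ` U J)"
proof (rule transformation_group.intro)
  fix g :: "('k, 'n) sqmat \<Rightarrow> ('k, 'n) sqmat" and x
  assume "g \<in> col_act J ` U J"
  then obtain u where u: "u \<in> U J" "g = col_act J u" by blast
  show "g x \<in> V J" using u by simp
  obtain v where "v \<in> U J" "v ** u = mat 1" using U_inverse[OF u(1)] .
  then have "col_act J v \<in> col_act J ` U J" "\<forall>x\<in>V J. col_act J v (g x) = x"
    by (simp_all add: u(2) col_act_col_act act_one)
  then show "\<exists>g'\<in>col_act J ` U J. \<forall>x\<in>V J. g' (g x) = x" by blast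
  fix g' :: "('k, 'n) sqmat \<Rightarrow> ('k, 'n) sqmat"
  assume "g' \<in> col_act J ` U J"
  then obtain u' where u': "u' \<in> U J" "g' = col_act J u'" by blast
  have "col_act J (u ** u') \<in> col_act J ` U J" using U_mult[OF u(1) u'(1)] by (rule imageI)
  moreover have "\<forall>x\<in>V J. col_act J (u ** u') x = g (g' x)"
    by (simp add: u u' col_act_col_act)
  ultimately show "\<exists>k\<in>col_act J ` U J. \<forall>x\<in>V J. k x = g (g' x)" by blast
next
  have "col_act J (mat 1) \<in> col_act J ` (U J :: ('k, 'n) sqmat set)"
    using one_in_U by (rule imageI)
  then show "\<exists>e\<in>col_act J ` U J. \<forall>x\<in>V J. e x = (x :: ('k, 'n) sqmat)"
    using act_one(2) by blast
qed

lemma commuting_actions_U: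
  "commuting_actions (V J :: ('k::{field,finite}, 'n) sqmat set) (row_act J ` U J) (col_act J ` U J)"
proof (intro commuting_actions.intro commuting_actions_axioms.intro
    transformation_group_row_act transformation_group_col_act)
  fix g h :: "('k, 'n) sqmat \<Rightarrow> ('k, 'n) sqmat" and x
  assume "g \<in> row_act J ` U J" "h \<in> col_act J ` U J"
  then show "g (h x) = h (g x)" using row_act_col_act by blast
qed

end

section \<open>Main conditions and templates\<close>

lemma main_conditions_iff:
  "(i, j) \<in> main_conditions A \<longleftrightarrow> A $ i $ j \<noteq> 0 \<and> (\<forall>l>j. A $ i $ l = 0)"
  by (simp add: main_conditions_def)

lemma main_conditions_unique:
  "(i, j) \<in> main_conditions A \<Longrightarrow> (i, j') \<in> main_conditions A \<Longrightarrow> j = j'"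
  unfolding main_conditions_iff by (metis linorder_neqE)

lemma main_condition_of_nonzero:
  assumes "A $ i $ l \<noteq> 0"
  obtains j where "l \<le> j" "(i, j) \<in> main_conditions A"
proof -
  let ?S = "{l. A $ i $ l \<noteq> 0}"
  have "Max ?S \<in> ?S" using assms by (intro Max_in) auto
  moreover have "\<And>k. k \<in> ?S \<Longrightarrow> k \<le> Max ?S" by simp
  ultimately have "(i, Max ?S) \<in> main_conditions A" "l \<le> Max ?S"
    using assms unfolding main_conditions_iff by (auto simp del: Max_ge) (metis leD)
  then show ?thesis using that by blast
qed

lemma template_zero:
  "template A \<Longrightarrow> (i, j) \<in> main_conditions A \<Longrightarrow> i < k \<Longrightarrow> k < j \<Longrightarrow> A $ k $ j = 0"
  unfolding template_def by blast

text \<open>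
  The columns are weighted by powers of two according to their rank, as the digits of a binary
  number.  Clearing an entry then outweighs any changes to its left.
\<close>

lemma sum_two_powers_card_lessThan:
  "(\<Sum>l\<in>{..<j}. 2 ^ card {..<l}) < (2 :: nat) ^ card {..<j :: 'n::{finite,linorder}}"
proof -
  have mono: "card {..<l} < card {..<l'}" if "l < l'" for l l' :: 'n
    using that by (intro psubset_card_mono) auto
  have inj: "inj_on (\<lambda>l. card {..<l}) {..<j}"
    by (rule inj_onI) (metis mono less_irrefl linorder_neqE)
  have "(\<Sum>l\<in>{..<j}. 2 ^ card {..<l}) = sum ((^) (2 :: nat)) ((\<lambda>l. card {..<l}) ` {..<j})"
    using inj by (simp add: sum.reindex o_def)
  also have "\<dots> \<le> sum ((^) 2) {0..<card {..<j}}"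
    by (rule sum_mono2) (auto intro: mono)
  also have "\<dots> < 2 ^ card {..<j}" by (simp add: sum_power2)
  finally show ?thesis .
qed

definition support_weight :: "('n::{finite,linorder} \<Rightarrow> 'k::zero) \<Rightarrow> nat" where
  "support_weight f = (\<Sum>l\<in>{l. f l \<noteq> 0}. 2 ^ card {..<l})"

lemma support_weight_less:
  assumes "f j \<noteq> 0" "g j = 0" "\<And>l. j < l \<Longrightarrow> g l = f l"
  shows "support_weight g < support_weight f"
proof -
  let ?w = "\<lambda>l. 2 ^ card {..<l} :: nat" and ?S = "{l. j < l \<and> f l \<noteq> 0}"
  have "support_weight g \<le> sum ?w ({..<j} \<union> ?S)"
    unfolding support_weight_def
  proof (rule sum_mono2)
    show "{l. g l \<noteq> 0} \<subseteq> {..<j} \<union> ?S"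
    proof
      fix l assume "l \<in> {l. g l \<noteq> 0}"
      then show "l \<in> {..<j} \<union> ?S"
        using assms(2) assms(3)[of l] by (cases l j rule: linorder_cases) auto
    qed
  qed auto
  also have "\<dots> = sum ?w {..<j} + sum ?w ?S" by (rule sum.union_disjoint) auto
  also have "\<dots> < ?w j + sum ?w ?S" using sum_two_powers_card_lessThan[of j] by simp
  also have "\<dots> = sum ?w (insert j ?S)" by simp
  also have "\<dots> \<le> support_weight f"
    unfolding support_weight_def by (rule sum_mono2) (use assms(1) in auto)
  finally show ?thesis .
qed

context row_closed_pattern
begin

lemma main_conditions_J: "A \<in> V J \<Longrightarrow> (i, j) \<in> main_conditions A \<Longrightarrow> (i, j) \<in> J"
  by (auto simp: main_conditions_iff V_def)

lemma template_distinct_columns: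
  assumes "template A" "A \<in> V J" shows "inj_on snd (main_conditions A)"
proof (rule inj_onI, clarsimp)
  fix i i' j assume ij: "(i, j) \<in> main_conditions A" "(i', j) \<in> main_conditions A"
  have "i < j" "i' < j" using main_conditions_J ij assms(2) J_less by blast+
  then show "i = i'"
    using template_zero[OF assms(1) ij(1), of i'] template_zero[OF assms(1) ij(2), of i] ij
    by (metis linorder_neqE main_conditions_iff)
qed

text \<open>
  In a row orbit choose an element whose rows have the least total \<open>support_weight\<close>.  If a main
  condition had a nonzero entry below it, subtracting a multiple of its row would clear that entry
  and change only positions further left, lowering the weight.
\<close>

lemma template_in_row_orbit:
  fixes B :: "('k::{field,finite}, 'n) sqmat"
  assumes B: "B \<in> V J"
  obtains u where "u \<in> U J" "template (row_act J u B)"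
proof -
  define \<Phi> :: "('k, 'n) sqmat \<Rightarrow> nat" where "\<Phi> T = (\<Sum>k\<in>UNIV. support_weight (\<lambda>l. T $ k $ l))" for T
  obtain u0 where u0: "u0 \<in> U J" and min: "\<And>u. u \<in> U J \<Longrightarrow> \<Phi> (row_act J u0 B) \<le> \<Phi> (row_act J u B)"
    using ex_has_least_nat[of "\<lambda>u. u \<in> U J" "mat 1" "\<lambda>u. \<Phi> (row_act J u B)"] one_in_U by blast
  define T where "T = row_act J u0 B"
  have TV: "T \<in> V J" by (simp add: T_def)
  have "template T"
  proof (rule ccontr)
    assume "\<not> template T"
    then obtain i j k where ijk: "(i, j) \<in> main_conditions T" "i < k" "k < j" "T $ k $ j \<noteq> 0"
      unfolding template_def by blast
    have ik: "(i, k) \<in> J" using J_row[OF main_conditions_J[OF TV ijk(1)] ijk(2)] .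
    have Tij: "T $ i $ j \<noteq> 0" "\<And>l. j < l \<Longrightarrow> T $ i $ l = 0"
      using ijk(1) by (simp_all add: main_conditions_iff)
    define c where "c = - T $ k $ j / T $ i $ j"
    define e :: "('k, 'n) sqmat" where
      "e = (\<chi> r s. if r = i \<and> s = k then c else if r = s then 1 else 0)"
    have eU: "e \<in> U J" using ik J_less[OF ik] by (auto simp: U_iff e_def)
    have sum: "(\<Sum>m\<in>{..<r}. e $ m $ r * T $ m $ s) = (if r = k then c * T $ i $ s else 0)" for r s
    proof -
      have "(\<Sum>m\<in>{..<r}. e $ m $ r * T $ m $ s)
          = (\<Sum>m\<in>{..<r}. if m = i then (if r = k then c * T $ i $ s else 0) else 0)"
        by (rule sum.cong) (auto simp: e_def)
      then show ?thesis using ijk(2) by simp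
    qed
    have other: "row_act J e T $ r $ s = T $ r $ s" if "r \<noteq> k" for r s
      using that V_entry[OF TV, of r s] by (auto simp: row_act_entry[OF eU] sum)
    have kJ: "row_act J e T $ k $ s = (if (k, s) \<in> J then T $ k $ s + c * T $ i $ s else 0)" for s
      by (simp add: row_act_entry[OF eU] sum)
    have "support_weight (\<lambda>l. row_act J e T $ k $ l) < support_weight (\<lambda>l. T $ k $ l)"
    proof (rule support_weight_less[of _ j])
      show "row_act J e T $ k $ j = 0" using Tij(1) by (simp add: kJ c_def)
      show "row_act J e T $ k $ l = T $ k $ l" if "j < l" for l
        using Tij(2)[OF that] V_entry[OF TV, of k l] by (auto simp: kJ)
    qed (rule ijk(4))
    moreover have "support_weight (\<lambda>l. row_act J e T $ r $ l) \<le> support_weight (\<lambda>l. T $ r $ l)" for r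
      using other[of r] calculation by (cases "r = k") auto
    ultimately have "\<Phi> (row_act J e T) < \<Phi> T"
      unfolding \<Phi>_def by (intro sum_strict_mono_ex1) auto
    moreover have "row_act J e T = row_act J (u0 ** e) B"
      unfolding T_def by (rule row_act_row_act[OF eU])
    ultimately show False using min[OF U_mult[OF u0 eU]] T_def by simp
  qed
  then show ?thesis using that u0 T_def by blast
qed

text \<open>
  The entries of \<open>v\<close> that modify column \<open>s\<close> sit in row \<open>s\<close>, which a normal column makes empty.
\<close>

lemma col_act_normal_column:
  fixes B :: "('k::field, 'n) sqmat"
  assumes "v \<in> U J" "B \<in> V J" "normal_column J s"
  shows "col_act J v B $ i $ s = B $ i $ s"
proof -
  have "v $ s $ l = 0" if "s < l" for l
    using U_offdiag[OF assms(1), of s l] assms(3) that by (auto simp: normal_column_def)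
  then show ?thesis using V_entry[OF assms(2), of i s] by (auto simp: col_act_entry[OF assms(1)])
qed

lemma col_act_beyond:
  fixes B :: "('k::field, 'n) sqmat"
  assumes "v \<in> U J" "B \<in> V J" "\<And>l. j < l \<Longrightarrow> B $ i $ l = 0" "j \<le> l"
  shows "col_act J v B $ i $ l = B $ i $ l"
  using V_entry[OF assms(2), of i l] assms(3,4) by (auto simp: col_act_entry[OF assms(1)])

lemma main_conditions_col_act:
  fixes B :: "('k::field, 'n) sqmat"
  assumes v: "v \<in> U J" and B: "B \<in> V J"
  shows "main_conditions (col_act J v B) = main_conditions B"
proof -
  have sub: "(i, j) \<in> main_conditions (col_act J v B)" if ij: "(i, j) \<in> main_conditions B" for i j
  proof -
    have "\<And>l. j < l \<Longrightarrow> B $ i $ l = 0" using ij by (simp add: main_conditions_iff)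
    from col_act_beyond[OF v B this] show ?thesis using ij by (simp add: main_conditions_iff)
  qed
  have "(i, j) \<in> main_conditions B" if ij: "(i, j) \<in> main_conditions (col_act J v B)" for i j
  proof -
    have "\<exists>l. B $ i $ l \<noteq> 0"
    proof (rule ccontr)
      assume "\<not> ?thesis"
      then have "col_act J v B $ i $ j = 0" by (simp add: col_act_entry[OF v])
      then show False using ij by (simp add: main_conditions_iff)
    qed
    then obtain l where "B $ i $ l \<noteq> 0" by blast
    then obtain j' where j': "(i, j') \<in> main_conditions B" by (rule main_condition_of_nonzero)
    then show ?thesis using sub[OF j'] main_conditions_unique[OF ij] by simp
  qed
  then show ?thesis using sub by auto
qed

end

text \<open>
  The rows that can change row \<open>a\<close>: those above it that still have an entry to the right of
  column \<open>a\<close> and so survive the truncation.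
\<close>

definition active_rows :: "('k::zero, 'n::{finite,linorder}) sqmat \<Rightarrow> 'n \<Rightarrow> 'n set" where
  "active_rows A a = {i. i < a \<and> (\<exists>b>a. (i, b) \<in> main_conditions A)}"

lemma not_active_row_zero:
  assumes "i < a" "i \<notin> active_rows A a" "a < l" shows "A $ i $ l = 0"
proof (rule ccontr)
  assume "A $ i $ l \<noteq> 0"
  then obtain j where "l \<le> j" "(i, j) \<in> main_conditions A" by (rule main_condition_of_nonzero)
  then show False using assms by (auto simp: active_rows_def)
qed

lemma R_rows_subset_active: "R_rows A a b \<subseteq> active_rows A a"
  by (auto simp: R_rows_def active_rows_def)

lemma active_combination_last:
  fixes A :: "('k::field, 'n::{finite,linorder}) sqmat"
  assumes distinct: "inj_on snd (main_conditions A)"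
    and i1: "i1 \<in> active_rows A a" "w i1 \<noteq> 0"
  obtains i b where "(i, b) \<in> main_conditions A" "i < a" "a < b"
    "(\<Sum>i'\<in>active_rows A a. w i' * A $ i' $ b) \<noteq> 0"
    "\<forall>l>b. (\<Sum>i'\<in>active_rows A a. w i' * A $ i' $ l) = 0"
    "\<forall>i'\<in>active_rows A a. \<forall>b'. w i' \<noteq> 0 \<longrightarrow> (i', b') \<in> main_conditions A \<longrightarrow> b' \<le> b"
proof -
  define b where "b i = (THE b. (i, b) \<in> main_conditions A)" for i
  have b_eq: "b i = j" if "(i, j) \<in> main_conditions A" for i j
    unfolding b_def using that main_conditions_unique by (intro the_equality)
  have b: "(i, b i) \<in> main_conditions A" "a < b i" "i < a" if "i \<in> active_rows A a" for i
    using that b_eq by (auto simp: active_rows_def)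
  have inj: "inj_on b (active_rows A a)"
    using b(1) distinct by (intro inj_onI) (metis inj_onD snd_conv prod.inject)
  have zero: "A $ i $ l = 0" if "i \<in> active_rows A a" "b i < l" for i l
    using b(1)[OF that(1)] that(2) by (simp add: main_conditions_iff)
  obtain i where i: "i \<in> active_rows A a" "w i \<noteq> 0"
      "(\<Sum>i'\<in>active_rows A a. w i' * A $ i' $ b i) = w i * A $ i $ b i"
      "\<forall>i'\<in>active_rows A a. w i' \<noteq> 0 \<longrightarrow> b i' \<le> b i"
    by (rule last_column_of_combination[of "active_rows A a" b "\<lambda>i l. A $ i $ l" i1 w,
          OF finite _ inj i1]) (use zero in blast, rule that)
  show ?thesis
  proof (rule that[OF b(1,3,2)[OF i(1)]])
    show "(\<Sum>i'\<in>active_rows A a. w i' * A $ i' $ b i) \<noteq> 0"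
      using i b(1)[OF i(1)] by (simp add: main_conditions_iff)
    show "\<forall>l>b i. (\<Sum>i'\<in>active_rows A a. w i' * A $ i' $ l) = 0"
    proof (intro allI impI sum.neutral ballI)
      fix l i' assume i': "b i < l" "i' \<in> active_rows A a"
      show "w i' * A $ i' $ l = 0"
        using i(4) i' zero[OF i'(2), of l] by (cases "w i' = 0") force+
    qed
    show "\<forall>i'\<in>active_rows A a. \<forall>b'. w i' \<noteq> 0 \<longrightarrow> (i', b') \<in> main_conditions A \<longrightarrow> b' \<le> b i"
      using i(4) b_eq by blast
  qed
qed

context row_closed_pattern
begin

lemma row_act_active:
  fixes A :: "('k::field, 'n) sqmat"
  assumes "u \<in> U J" "(a, l) \<in> J"
  shows "row_act J u A $ a $ l = A $ a $ l + (\<Sum>i\<in>active_rows A a. u $ i $ a * A $ i $ l)"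
proof -
  have "(\<Sum>i\<in>{..<a}. u $ i $ a * A $ i $ l) = (\<Sum>i\<in>active_rows A a. u $ i $ a * A $ i $ l)"
    by (rule sum.mono_neutral_right)
      (use not_active_row_zero[of _ a A l] J_less[OF assms(2)] in \<open>auto simp: active_rows_def\<close>)
  then show ?thesis using assms(2) by (simp add: row_act_entry[OF assms(1)])
qed

text \<open>
  A row operation that leads from one template to another, even with column operations
  afterwards, adds to row \<open>a\<close> only rows whose main condition lies left of that of row \<open>a\<close>.
  Otherwise the added combination would create a rightmost entry of row \<open>a\<close> below an earlier
  main condition, contradicting the template property.  Going down the rows, this also shows that
  main conditions and their values are preserved.
\<close>

lemma template_row_changes:
  fixes A :: "('k::field, 'n) sqmat"
  assumes A: "A \<in> V J" "template A" and uv: "u \<in> U J" "v \<in> U J"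
    and T: "template (col_act J v (row_act J u A))"
  shows "main_conditions (col_act J v (row_act J u A)) = main_conditions A"
    and "(a, j) \<in> main_conditions A \<Longrightarrow> row_act J u A $ a $ j = A $ a $ j"
    and "(i, b) \<in> main_conditions A \<Longrightarrow> i < a \<Longrightarrow> (a, b) \<in> J \<Longrightarrow> u $ i $ a \<noteq> 0
      \<Longrightarrow> \<exists>b'>b. (a, b') \<in> main_conditions A"
proof -
  define A' where "A' = row_act J u A"
  define T where "T = col_act J v A'"
  have A'V: "A' \<in> V J" by (simp add: A'_def)
  have mcT: "main_conditions T = main_conditions A'"
    unfolding T_def by (rule main_conditions_col_act[OF uv(2) A'V])
  have tT: "template T" using T by (simp add: T_def A'_def)
  note distinct = template_distinct_columns[OF A(2,1)]
  have main: "(\<forall>j. (a, j) \<in> main_conditions A' \<longleftrightarrow> (a, j) \<in> main_conditions A) \<and>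
      (\<forall>j. (a, j) \<in> main_conditions A \<longrightarrow> A' $ a $ j = A $ a $ j) \<and>
      (\<forall>i b. (i, b) \<in> main_conditions A \<and> i < a \<and> (a, b) \<in> J \<and> u $ i $ a \<noteq> 0
        \<longrightarrow> (\<exists>b'>b. (a, b') \<in> main_conditions A))" (is "?P a") for a
  proof (induction a rule: finite_linorder_less_induct)
    case (1 a)
    show ?case
    proof (cases "\<exists>i\<in>active_rows A a. u $ i $ a \<noteq> 0 \<and> (\<exists>l. (a, l) \<in> J)")
      case False
      have row: "A' $ a $ l = A $ a $ l" for l
      proof (cases "(a, l) \<in> J")
        case True
        then have "(\<Sum>i\<in>active_rows A a. u $ i $ a * A $ i $ l) = 0"
          using False by (intro sum.neutral) auto
        then show ?thesis using row_act_active[OF uv(1) True] by (simp add: A'_def)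
      next
        case False
        then show ?thesis using V_entry[OF A'V, of a l] V_entry[OF A(1), of a l] by force
      qed
      have "u $ i $ a = 0" if "(i, b) \<in> main_conditions A" "i < a" "(a, b) \<in> J" for i b
        using that False J_less[OF that(3)] by (auto simp: active_rows_def)
      then show ?thesis using row by (auto simp: main_conditions_iff)
    next
      case True
      then obtain i1 l1 where i1: "i1 \<in> active_rows A a" "u $ i1 $ a \<noteq> 0" "(a, l1) \<in> J" by blast
      obtain i b where ib: "(i, b) \<in> main_conditions A" "i < a" "a < b"
          and ne: "(\<Sum>i'\<in>active_rows A a. u $ i' $ a * A $ i' $ b) \<noteq> 0"
          and beyond: "\<forall>l>b. (\<Sum>i'\<in>active_rows A a. u $ i' $ a * A $ i' $ l) = 0"
          and le: "\<forall>i'\<in>active_rows A a. \<forall>b'. u $ i' $ a \<noteq> 0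
            \<longrightarrow> (i', b') \<in> main_conditions A \<longrightarrow> b' \<le> b"
        by (rule active_combination_last[of A i1 a "\<lambda>i. u $ i $ a", OF distinct i1(1,2)]) (rule that)
      have aJ: "(a, l) \<in> J" if "a < l" for l using J_row[OF i1(3) that] .
      have A'_entry: "A' $ a $ l = A $ a $ l + (\<Sum>i'\<in>active_rows A a. u $ i' $ a * A $ i' $ l)"
        if "a < l" for l using row_act_active[OF uv(1) aJ[OF that]] by (simp add: A'_def)
      \<comment> \<open>If not, the combination makes column \<open>b\<close> the last one of row \<open>a\<close>, underneath \<open>(i, b)\<close>.\<close>
      have "\<exists>b'>b. (a, b') \<in> main_conditions A"
      proof (rule ccontr)
        assume no: "\<not> ?thesis"
        have A0: "A $ a $ l = 0" if "b < l" for l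
        proof (rule ccontr)
          assume "A $ a $ l \<noteq> 0"
          then obtain j where "l \<le> j" "(a, j) \<in> main_conditions A" by (rule main_condition_of_nonzero)
          then show False using no that by auto
        qed
        have "A $ a $ b = 0" by (rule template_zero[OF A(2) ib])
        then have "(a, b) \<in> main_conditions A'"
          using ne ib(3) A0 beyond by (simp add: main_conditions_iff A'_entry)
        then have "T $ a $ b \<noteq> 0" unfolding mcT[symmetric] by (simp add: main_conditions_iff)
        moreover have "(i, b) \<in> main_conditions T" unfolding mcT using 1[OF ib(2)] ib(1) by blast
        ultimately show False using template_zero[OF tT _ ib(2,3)] by blast
      qed
      then obtain b' where b': "b < b'" "(a, b') \<in> main_conditions A" by blast
      have eq: "A' $ a $ l = A $ a $ l" if "b' \<le> l" for l
        using that b'(1) ib(3) beyond by (simp add: A'_entry)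
      then have mc: "(a, b') \<in> main_conditions A'" using b'(2) by (simp add: main_conditions_iff)
      show ?thesis
      proof (intro conjI allI impI)
        show "(a, j) \<in> main_conditions A' \<longleftrightarrow> (a, j) \<in> main_conditions A" for j
          using mc b'(2) main_conditions_unique by metis
        show "A' $ a $ j = A $ a $ j" if "(a, j) \<in> main_conditions A" for j
          using main_conditions_unique[OF that b'(2)] eq by simp
        fix i' c assume ic: "(i', c) \<in> main_conditions A \<and> i' < a \<and> (a, c) \<in> J \<and> u $ i' $ a \<noteq> 0"
        then have "i' \<in> active_rows A a" using J_less[of a c] by (auto simp: active_rows_def)
        then have "c \<le> b" using le ic by blast
        then show "\<exists>b'>c. (a, b') \<in> main_conditions A" using b' by (intro exI[of _ b']) auto
      qed
    qed
  qed
  show "main_conditions (col_act J v (row_act J u A)) = main_conditions A"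
    using main mcT unfolding T_def A'_def by auto
  show "row_act J u A $ a $ j = A $ a $ j" if "(a, j) \<in> main_conditions A"
    using main that unfolding A'_def by blast
  show "\<exists>b'>b. (a, b') \<in> main_conditions A"
    if "(i, b) \<in> main_conditions A" "i < a" "(a, b) \<in> J" "u $ i $ a \<noteq> 0"
    using main that by blast
qed

text \<open>
  A nontrivial change of row \<open>a\<close> would show up in the column of a main condition \<open>(i, b)\<close> above
  it.  Both templates have this main condition, hence both vanish at \<open>(a, b)\<close>.
\<close>

lemma template_unique_in_row_orbit:
  fixes A :: "('k::field, 'n) sqmat"
  assumes A: "A \<in> V J" "template A" and u: "u \<in> U J" and T: "template (row_act J u A)"
  shows "row_act J u A = A"
proof (rule ccontr)
  assume "row_act J u A \<noteq> A"
  then obtain a l where al: "row_act J u A $ a $ l \<noteq> A $ a $ l" by (auto simp: vec_eq_iff)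
  then have J: "(a, l) \<in> J"
    using V_entry[OF A(1), of a l] V_entry[OF act_in_V(1)[of J u A], of a l] by force
  have mc: "main_conditions (row_act J u A) = main_conditions A"
    using template_row_changes(1)[OF A u one_in_U] T by (simp add: act_one)
  obtain i1 where i1: "i1 \<in> active_rows A a" "u $ i1 $ a \<noteq> 0"
    using al unfolding row_act_active[OF u J] by (metis (no_types, lifting) add.right_neutral mult_zero_left sum.neutral)
  obtain i b where ib: "(i, b) \<in> main_conditions A" "i < a" "a < b"
      and ne: "(\<Sum>i'\<in>active_rows A a. u $ i' $ a * A $ i' $ b) \<noteq> 0"
    by (rule active_combination_last[of A i1 a "\<lambda>i. u $ i $ a",
          OF template_distinct_columns[OF A(2,1)] i1]) (rule that)
  have "row_act J u A $ a $ b \<noteq> A $ a $ b"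
    using row_act_active[OF u J_row[OF J ib(3)], of A] ne by simp
  moreover have "A $ a $ b = 0" by (rule template_zero[OF A(2) ib])
  moreover have "row_act J u A $ a $ b = 0"
    by (rule template_zero[OF T]) (use ib mc in auto)
  ultimately show False by simp
qed

text \<open>
  If the rows have distinct last columns, column operations reach every matrix that differs only
  at nonnormal positions to the left of the last nonzero entries.  Such a column \<open>j\<close> may receive any
  combination of the columns to its right, and the rows that are nonzero there are independent.
\<close>

lemma col_orbit_all_arms:
  fixes B :: "('k::field, 'n) sqmat"
  assumes B: "B \<in> V J"
    and distinct: "inj_on snd (main_conditions B)"
    and X: "X \<in> V J"
    and arms: "\<And>i j. X $ i $ j \<noteq> B $ i $ j \<Longrightarrow> \<not> normal_column J j \<and> (\<exists>b>j. (i, b) \<in> main_conditions B)"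
  obtains v where "v \<in> U J" "col_act J v B = X"
proof -
  have "\<exists>z. (\<forall>l. z l \<noteq> 0 \<longrightarrow> j < l) \<and>
      (\<forall>i\<in>active_rows B j. (\<Sum>l\<in>UNIV. B $ i $ l * z l) = X $ i $ j - B $ i $ j)" for j
  proof -
    define b where "b i = (THE b. (i, b) \<in> main_conditions B)" for i
    have b_eq: "b i = l" if "(i, l) \<in> main_conditions B" for i l
      unfolding b_def using that main_conditions_unique by (intro the_equality)
    have b: "(i, b i) \<in> main_conditions B" "j < b i" if "i \<in> active_rows B j" for i
      using that b_eq by (auto simp: active_rows_def)
    have "\<exists>z. (\<forall>l. z l \<noteq> 0 \<longrightarrow> l \<in> b ` active_rows B j) \<and>
        (\<forall>i\<in>active_rows B j. (\<Sum>l\<in>UNIV. B $ i $ l * z l) = X $ i $ j - B $ i $ j)"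
    proof (rule distinct_last_columns_solvable)
      show "B $ i $ b i \<noteq> 0" if "i \<in> active_rows B j" for i
        using b(1)[OF that] by (simp add: main_conditions_iff)
      show "B $ i $ l = 0" if "i \<in> active_rows B j" "b i < l" for i l
        using b(1)[OF that(1)] that(2) by (simp add: main_conditions_iff)
      show "inj_on b (active_rows B j)" using b(1) distinct by (intro inj_onI) (metis inj_onD snd_conv prod.inject)
    qed simp
    then obtain z where z: "\<forall>l. z l \<noteq> 0 \<longrightarrow> l \<in> b ` active_rows B j"
        "\<forall>i\<in>active_rows B j. (\<Sum>l\<in>UNIV. B $ i $ l * z l) = X $ i $ j - B $ i $ j" by (elim exE conjE)
    have "j < l" if "z l \<noteq> 0" for l using z(1) that b(2) by auto
    then show ?thesis using z(2) by (intro exI[of _ z]) simp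
  qed
  then have "\<exists>z. \<forall>j. (\<forall>l. z j l \<noteq> 0 \<longrightarrow> j < l) \<and>
      (\<forall>i\<in>active_rows B j. (\<Sum>l\<in>UNIV. B $ i $ l * z j l) = X $ i $ j - B $ i $ j)"
    by (intro choice allI)
  then obtain z where z': "\<forall>j. (\<forall>l. z j l \<noteq> 0 \<longrightarrow> j < l) \<and>
      (\<forall>i\<in>active_rows B j. (\<Sum>l\<in>UNIV. B $ i $ l * z j l) = X $ i $ j - B $ i $ j)"
    by (elim exE)
  have z: "\<And>j l. z j l \<noteq> 0 \<Longrightarrow> j < l"
      "\<And>j i. i \<in> active_rows B j \<Longrightarrow> (\<Sum>l\<in>UNIV. B $ i $ l * z j l) = X $ i $ j - B $ i $ j"
    using z' by auto
  define v :: "('k, 'n) sqmat" where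
    "v = (\<chi> j l. if j = l then 1 else if normal_column J j then 0 else z j l)"
  have v: "v \<in> U J"
    using z(1) J_if_not_normal J_less by (fastforce simp: U_iff v_def)
  have "col_act J v B $ i $ j = X $ i $ j" for i j
  proof (cases "(i, j) \<in> J \<and> \<not> normal_column J j")
    case False
    then have "X $ i $ j = B $ i $ j"
      using arms[of i j] V_entry[OF B, of i j] V_entry[OF X, of i j] by force
    moreover have "col_act J v B $ i $ j = B $ i $ j"
      using False col_act_normal_column[OF v B, of j i] V_entry[OF B, of i j]
        V_entry[OF act_in_V(2)[of J v B], of i j] by force
    ultimately show ?thesis by simp
  next
    case True
    have "(\<Sum>l\<in>{j<..}. B $ i $ l * v $ j $ l) = (\<Sum>l\<in>{j<..}. B $ i $ l * z j l)"
      using True by (intro sum.cong) (auto simp: v_def)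
    also have "\<dots> = (\<Sum>l\<in>UNIV. B $ i $ l * z j l)"
      by (rule sum.mono_neutral_left) (use z(1) in auto)
    also have "\<dots> = X $ i $ j - B $ i $ j"
    proof (cases "i \<in> active_rows B j")
      case inactive: False
      have "i < j" using True J_less by blast
      have "(\<Sum>l\<in>UNIV. B $ i $ l * z j l) = 0"
      proof (rule sum.neutral, rule ballI)
        fix l
        show "B $ i $ l * z j l = 0"
          using z(1)[of j l] not_active_row_zero[OF \<open>i < j\<close> inactive, of l] by (cases "z j l = 0") auto
      qed
      moreover have "X $ i $ j = B $ i $ j"
        using arms[of i j] inactive \<open>i < j\<close> by (auto simp: active_rows_def)
      ultimately show ?thesis by simp
    qed (rule z(2))
    finally show ?thesis using True by (simp add: col_act_entry[OF v])
  qed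
  then show ?thesis using that v by (simp add: vec_eq_iff)
qed

text \<open>
  Both orbits are parametrized by the matrices \<open>Z\<close> supported on the positions \<open>(i, j)\<close> with \<open>j\<close>
  nonnormal and \<open>i\<close> active for \<open>j\<close>.  On the column side these are the possible differences to
  \<open>A\<close>; on the row side they are the coefficients of row operations that survive truncation, and
  different coefficients give different results by independence of the active rows.
\<close>

lemma card_col_orbit_eq_card_row_orbit:
  fixes A :: "('k::{field,finite}, 'n) sqmat"
  assumes A: "A \<in> V J" "template A"
  shows "card (orbit (col_act J ` U J) A) = card (orbit (row_act J ` U J) A)"
proof -
  note distinct = template_distinct_columns[OF A(2,1)]
  define Z where "Z = {X :: ('k, 'n) sqmat. \<forall>i j. X $ i $ j \<noteq> 0 \<longrightarrow> \<not> normal_column J j \<and> i \<in> active_rows A j}"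
  have Z_V: "X \<in> V J" if "X \<in> Z" for X
    unfolding V_def
  proof (intro CollectI allI impI)
    fix i j assume "X $ i $ j \<noteq> 0"
    then have "i \<in> active_rows A j" using that unfolding Z_def by blast
    then obtain b where "i < j" "(i, b) \<in> main_conditions A" unfolding active_rows_def by blast
    then show "(i, j) \<in> J" using J_row main_conditions_J[OF A(1)] by blast
  qed
  have col: "orbit (col_act J ` U J) A = (+) A ` Z"
  proof (intro equalityI subsetI)
    fix X assume "X \<in> orbit (col_act J ` U J) A"
    then obtain v where v: "v \<in> U J" "X = col_act J v A" by (auto simp: orbit_def)
    have "X - A \<in> Z"
      unfolding Z_def
    proof (intro CollectI allI impI)
      fix i j assume "(X - A) $ i $ j \<noteq> 0"
      then have ne: "col_act J v A $ i $ j \<noteq> A $ i $ j" using v by simp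
      then have "(i, j) \<in> J"
        using V_entry[OF A(1), of i j] V_entry[OF act_in_V(2)[of J v A], of i j] by force
      then have "i < j" by (rule J_less)
      have "\<exists>l\<in>{j<..}. A $ i $ l * v $ j $ l \<noteq> 0"
      proof (rule ccontr)
        assume "\<not> ?thesis"
        then have "(\<Sum>l\<in>{j<..}. A $ i $ l * v $ j $ l) = 0" by (intro sum.neutral) blast
        then show False using ne \<open>(i, j) \<in> J\<close> by (simp add: col_act_entry[OF v(1)])
      qed
      then show "\<not> normal_column J j \<and> i \<in> active_rows A j"
        using col_act_normal_column[OF v(1) A(1), of j i] ne not_active_row_zero[OF \<open>i < j\<close>, of A] by auto
    qed
    then show "X \<in> (+) A ` Z" by (intro image_eqI[of _ _ "X - A"]) auto
  next
    fix X assume "X \<in> (+) A ` Z"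
    then obtain Y where Y: "Y \<in> Z" "X = A + Y" by blast
    have "X \<in> V J" using V_entry[OF A(1)] V_entry[OF Z_V[OF Y(1)]] unfolding V_def Y(2)
      by (auto simp: vector_add_component) (metis add.right_neutral)
    moreover have "\<not> normal_column J j \<and> (\<exists>b>j. (i, b) \<in> main_conditions A)"
      if "X $ i $ j \<noteq> A $ i $ j" for i j
      using that Y by (auto simp: Z_def active_rows_def)
    ultimately obtain v where "v \<in> U J" "col_act J v A = X"
      using col_orbit_all_arms[OF A(1) distinct, of X] by metis
    then show "X \<in> orbit (col_act J ` U J) A" by (auto simp: orbit_def)
  qed
  have one_add: "mat 1 + Y \<in> U J" if "Y \<in> Z" for Y using Z_V[OF that] by (simp add: U_def)
  have entry: "row_act J (mat 1 + Y) A $ a $ l = A $ a $ l + (\<Sum>i\<in>active_rows A a. Y $ i $ a * A $ i $ l)"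
    if "Y \<in> Z" "(a, l) \<in> J" for Y a l
  proof -
    have "(\<Sum>i\<in>active_rows A a. (mat 1 + Y) $ i $ a * A $ i $ l) = (\<Sum>i\<in>active_rows A a. Y $ i $ a * A $ i $ l)"
      by (rule sum.cong) (auto simp: active_rows_def mat_def)
    then show ?thesis using row_act_active[OF one_add[OF that(1)] that(2), of A] by simp
  qed
  have row: "orbit (row_act J ` U J) A = (\<lambda>Y. row_act J (mat 1 + Y) A) ` Z"
  proof (intro equalityI subsetI)
    fix X assume "X \<in> orbit (row_act J ` U J) A"
    then obtain u where u: "u \<in> U J" "X = row_act J u A" by (auto simp: orbit_def)
    define Y :: "('k, 'n) sqmat" where
      "Y = (\<chi> i j. if \<not> normal_column J j \<and> i \<in> active_rows A j then u $ i $ j else 0)"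
    have Y: "Y \<in> Z" by (auto simp: Z_def Y_def)
    have "X $ a $ l = row_act J (mat 1 + Y) A $ a $ l" for a l
    proof (cases "(a, l) \<in> J")
      case True
      have "(\<Sum>i\<in>active_rows A a. u $ i $ a * A $ i $ l) = (\<Sum>i\<in>active_rows A a. Y $ i $ a * A $ i $ l)"
        by (rule sum.cong) (auto simp: Y_def not_normal[OF True])
      then show ?thesis using entry[OF Y True] row_act_active[OF u(1) True, of A] u(2) by simp
    next
      case False
      then show ?thesis
        using u(2) V_entry[OF act_in_V(1)[of J u A], of a l]
          V_entry[OF act_in_V(1)[of J "mat 1 + Y" A], of a l] by force
    qed
    then have "X = row_act J (mat 1 + Y) A" by (simp add: vec_eq_iff)
    then show "X \<in> (\<lambda>Y. row_act J (mat 1 + Y) A) ` Z" using Y by blast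
  qed (use one_add in \<open>auto simp: orbit_def\<close>)
  have "inj_on (\<lambda>Y. row_act J (mat 1 + Y) A) Z"
  proof (rule inj_onI, rule ccontr)
    fix Y Y' assume Y: "Y \<in> Z" "Y' \<in> Z" and eq: "row_act J (mat 1 + Y) A = row_act J (mat 1 + Y') A"
      and "Y \<noteq> Y'"
    then obtain i1 a where ia: "Y $ i1 $ a \<noteq> Y' $ i1 $ a" by (auto simp: vec_eq_iff)
    then have "Y $ i1 $ a \<noteq> 0 \<or> Y' $ i1 $ a \<noteq> 0" by auto
    then have a: "\<not> normal_column J a" and i1: "i1 \<in> active_rows A a" using Y by (auto simp: Z_def)
    define w where "w i = Y $ i $ a - Y' $ i $ a" for i
    have "w i1 \<noteq> 0" using ia by (simp add: w_def)
    obtain i b where ib: "a < b" "(\<Sum>i'\<in>active_rows A a. w i' * A $ i' $ b) \<noteq> 0"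
      by (rule active_combination_last[of A i1 a w, OF distinct i1 \<open>w i1 \<noteq> 0\<close>]) (rule that)
    have "(\<Sum>i'\<in>active_rows A a. w i' * A $ i' $ b)
        = row_act J (mat 1 + Y) A $ a $ b - row_act J (mat 1 + Y') A $ a $ b"
      using entry[OF Y(1) J_if_not_normal[OF a ib(1)]] entry[OF Y(2) J_if_not_normal[OF a ib(1)]]
      by (simp add: w_def left_diff_distrib sum_subtractf)
    then show False using ib(2) eq by simp
  qed
  then show ?thesis unfolding row col by (simp add: card_image)
qed

end

section \<open>Column bases and linear functionals\<close>

text \<open>
  A combination of rows is a linear functional on the column space, so it is determined by its
  values on a column basis.
\<close>

lemma column_basis_functional_zero:
  fixes A :: "('k::field, 'n::finite) sqmat"
  assumes "is_column_basis A R C B" "\<And>s. s \<in> B \<Longrightarrow> (\<Sum>e\<in>R. d e * A $ e $ s) = 0" "s \<in> C"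
  shows "(\<Sum>e\<in>R. d e * A $ e $ s) = 0"
proof -
  let ?N = "{x :: 'k^'n. (\<Sum>e\<in>R. d e * x $ e) = 0}"
  have sub: "(\<Sum>e\<in>R. d e * subcolumn A R s $ e) = (\<Sum>e\<in>R. d e * A $ e $ s)" for s
    by (rule sum.cong) (auto simp: subcolumn_def)
  have "vec.subspace ?N"
    by (rule vec.subspaceI)
      (auto simp: distrib_left sum.distrib mult.left_commute sum_distrib_left[symmetric])
  moreover have "subcolumn A R ` B \<subseteq> ?N" using assms(2) sub by auto
  ultimately have "vec.span (subcolumn A R ` B) \<subseteq> ?N" by (intro vec.span_minimal)
  moreover have "subcolumn A R s \<in> vec.span (subcolumn A R ` B)"
    using assms(1,3) unfolding is_column_basis_def by (metis imageI vec.span_base)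
  ultimately show ?thesis using sub by auto
qed

text \<open>
  Conversely, a functional may be prescribed freely on a column basis.  The target is \<open>'k^1\<close> in
  order that \<open>matrix\<close> yields the coefficients of the functional.
\<close>

lemma column_basis_functional_exists:
  fixes A :: "('k::field, 'n::finite) sqmat"
  assumes "is_column_basis A R C B"
  obtains w where "\<forall>s\<in>B. (\<Sum>e\<in>R. w e * A $ e $ s) = x s"
proof -
  have inj: "inj_on (subcolumn A R) B" and ind: "vec.independent (subcolumn A R ` B)"
    using assms by (simp_all add: is_column_basis_def)
  define f :: "'k^'n \<Rightarrow> 'k^1" where "f v = (\<chi> _. x (the_inv_into B (subcolumn A R) v))" for v
  obtain g where g: "Vector_Spaces.linear (*s) (*s) g" "\<forall>v\<in>subcolumn A R ` B. g v = f v"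
    using vec.linear_independent_extend[OF ind, of f] by blast
  define w where "w e = matrix g $ 1 $ e" for e
  show ?thesis
  proof (rule that, rule ballI)
    fix s assume s: "s \<in> B"
    have "(\<Sum>e\<in>R. w e * A $ e $ s) = (\<Sum>e\<in>UNIV. w e * subcolumn A R s $ e)"
      by (rule sum.mono_neutral_cong_left) (auto simp: subcolumn_def)
    also have "\<dots> = (matrix g *v subcolumn A R s) $ 1"
      by (simp add: matrix_vector_mult_def w_def)
    also have "\<dots> = f (subcolumn A R s) $ 1" using matrix_works[OF g(1)] g(2) s by simp
    also have "\<dots> = x s" by (simp add: f_def the_inv_into_f_f[OF inj s])
    finally show "(\<Sum>e\<in>R. w e * A $ e $ s) = x s" .
  qed
qed

section \<open>Templates in the biorbit of a normal template\<close>

lemma intersection_not_y: "(a, s) \<in> main_hook_intersections p \<Longrightarrow> (a, s) \<notin> y_conditions J p"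
  by (simp add: y_conditions_def)

lemma y_not_normal: "(a, s) \<in> y_conditions J p \<Longrightarrow> \<not> normal_column J s"
  by (auto simp: y_conditions_def)

lemma y_arm: "(a, s) \<in> y_conditions J p \<Longrightarrow> (a, s) \<in> J \<and> (\<exists>b>s. (a, b) \<in> p)"
  by (auto simp: y_conditions_def hook_arm_def)

lemma intersection_iff:
  "(a, f) \<in> main_hook_intersections p \<longleftrightarrow>
    (\<exists>b e. (a, b) \<in> p \<and> (e, f) \<in> p \<and> e < a \<and> a < f \<and> f < b)"
  by (auto simp: main_hook_intersections_def)

lemma template_zero_at_intersection:
  "template T \<Longrightarrow> (a, f) \<in> main_hook_intersections (main_conditions T) \<Longrightarrow> T $ a $ f = 0"
  using template_zero by (auto simp: intersection_iff)

lemma R_rows_entry_zero: "e \<in> R_rows A a b \<Longrightarrow> b \<le> l \<Longrightarrow> A $ e $ l = 0"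
  by (auto simp: R_rows_def main_conditions_iff)

context row_closed_pattern
begin

lemma y_or_intersection:
  assumes "A \<in> V J" "(a, b) \<in> main_conditions A" "a < s" "s < b" "\<not> normal_column J s"
  shows "(a, s) \<in> y_conditions J (main_conditions A) \<or>
    (a, s) \<in> main_hook_intersections (main_conditions A)"
proof -
  have "(a, s) \<in> hook_arm J a b"
    using assms J_row[OF main_conditions_J[OF assms(1,2)]] by (simp add: hook_arm_def)
  then show ?thesis using assms by (auto simp: y_conditions_def)
qed

text \<open>
  Every nonnormal position strictly left of a main condition is a \<open>y\<close>-condition or a main hook
  intersection, and a normal template vanishes at both kinds.  So a nonnormal column contains no
  nonzero entry except a main condition.
\<close>

lemma normal_template_arm_zero:
  assumes "A \<in> V J" "normal_template J A" "(e, f) \<in> main_conditions A"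
    and "\<not> normal_column J s" "A $ e $ s \<noteq> 0"
  shows "s = f"
proof (rule ccontr)
  assume "s \<noteq> f"
  then have "s < f" using assms(3,5) by (metis linorder_neqE main_conditions_iff)
  moreover have "e < s" using V_entry[OF assms(1,5)] by (rule J_less)
  ultimately show False
    using y_or_intersection[OF assms(1,3) _ _ assms(4)] assms(2,5) template_zero_at_intersection[of A e s]
    by (auto simp: normal_template_def)
qed

text \<open>
  In particular the positions in the chosen sets \<open>Ca a\<close> are main hook intersections, where every
  template with these main conditions vanishes.
\<close>

lemma C_hat_not_normal_intersection:
  assumes "A \<in> V J" "normal_template J A" "(a, b) \<in> main_conditions A"
    and "s \<in> C_hat A a b" "\<not> normal_column J s"
  shows "(a, s) \<in> main_hook_intersections (main_conditions A)"
proof -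
  obtain e where e: "e \<in> R_rows A a b" "A $ e $ s \<noteq> 0" using assms(4) by (auto simp: C_hat_def)
  then obtain f where f: "(e, f) \<in> main_conditions A" "e < a" "a < f" "f < b"
    by (auto simp: R_rows_def)
  have "s = f" by (rule normal_template_arm_zero[OF assms(1,2) f(1) assms(5) e(2)])
  then show ?thesis using f assms(3) by (auto simp: intersection_iff)
qed

lemma intersection_normal_C_n:
  assumes "(a, b) \<in> main_conditions A" "(a, s) \<in> main_hook_intersections (main_conditions A)"
    and "normal_column J s"
  shows "s \<in> C_n J A a b"
proof -
  obtain b' e where be: "(a, b') \<in> main_conditions A" "(e, s) \<in> main_conditions A" "e < a" "a < s" "s < b'"
    using assms(2) by (auto simp: intersection_iff)
  then have "b' = b" using assms(1) main_conditions_unique by blast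
  then have "e \<in> R_rows A a b" "A $ e $ s \<noteq> 0" using be by (auto simp: R_rows_def main_conditions_iff)
  then show ?thesis using be \<open>b' = b\<close> assms(3) by (auto simp: C_n_def C_norm_def C_hat_def)
qed

text \<open>
  Column operations do not touch normal columns, and the row operations add only rows from
  \<open>R_rows A a b\<close>.  So in its normal columns a template of the biorbit differs from \<open>A\<close> by an
  element of the row space of the matrix \<open>\<Gamma>\<close> at \<open>a\<close>.
\<close>

lemma template_normal_entries:
  fixes A :: "('k::field, 'n) sqmat"
  assumes A: "A \<in> V J" "template A" and uv: "u \<in> U J" "v \<in> U J"
    and T: "template (col_act J v (row_act J u A))"
    and ab: "(a, b) \<in> main_conditions A" and s: "normal_column J s" "a < s"
  shows "col_act J v (row_act J u A) $ a $ s = A $ a $ s + (\<Sum>e\<in>R_rows A a b. u $ e $ a * A $ e $ s)"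
proof -
  have J: "(a, s) \<in> J" by (rule J_row[OF main_conditions_J[OF A(1) ab] s(2)])
  have "u $ e $ a = 0" if e: "e \<in> active_rows A a" "e \<notin> R_rows A a b" for e
  proof (rule ccontr)
    assume "u $ e $ a \<noteq> 0"
    obtain f where f: "(e, f) \<in> main_conditions A" "e < a" "a < f" using e(1) by (auto simp: active_rows_def)
    obtain b' where "f < b'" "(a, b') \<in> main_conditions A"
      using template_row_changes(3)[OF A uv T f(1,2) J_row[OF J f(3)]] \<open>u $ e $ a \<noteq> 0\<close> by blast
    then have "f < b" using main_conditions_unique[OF ab] by blast
    then show False using e(2) f by (auto simp: R_rows_def)
  qed
  then have "(\<Sum>e\<in>active_rows A a. u $ e $ a * A $ e $ s) = (\<Sum>e\<in>R_rows A a b. u $ e $ a * A $ e $ s)"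
    by (intro sum.mono_neutral_right) (use R_rows_subset_active[of A a b] in auto)
  then show ?thesis
    using col_act_normal_column[OF uv(2) act_in_V(1) s(1), of u A a] row_act_active[OF uv(1) J, of A] by simp
qed

text \<open>
  A position of \<open>H_n\<close> lies below a main condition within its leg, and a position of \<open>Ca\<close> is a main
  hook intersection; the template property gives zero at both.
\<close>

lemma template_vanishes:
  fixes A :: "('k::field, 'n) sqmat"
  assumes A: "A \<in> V J" "normal_template J A" "admissible_choice J A Ci Ca"
    and T: "template T" "main_conditions T = main_conditions A"
    and as: "(a, s) \<in> H_n J A \<union> chosen_positions A Ca"
  shows "T $ a $ s = 0"
proof -
  obtain b where ab: "(a, b) \<in> main_conditions A" and s: "s \<in> C_n J A a b \<or> s \<in> Ca a"
    using as by (auto simp: H_n_def chosen_positions_def)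
  from s show ?thesis
  proof
    assume "s \<in> C_n J A a b"
    then show ?thesis
      using template_zero[OF T(1)] T(2) by (auto simp: C_n_def C_norm_def C_hat_def)
  next
    assume "s \<in> Ca a"
    then have "s \<in> C_hat A a b" "\<not> normal_column J s"
      using A(3) ab unfolding admissible_choice_def C_norm_def by blast+
    then show ?thesis
      using C_hat_not_normal_intersection[OF A(1,2) ab] template_zero_at_intersection[OF T(1)] T(2) by simp
  qed
qed

text \<open>
  In row \<open>a\<close>, a nonnormal entry left of the main condition is a \<open>y\<close>-condition, where the two
  templates agree, or an intersection, where both vanish.  In the normal columns their difference
  is a combination of the rows of \<open>\<Gamma>\<close> that vanishes on the column basis \<open>C_n J A a b \<union> Ci a\<close>,
  hence everywhere.
\<close>

lemma template_determined:
  fixes A :: "('k::field, 'n) sqmat"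
  assumes A: "A \<in> V J" "normal_template J A" "admissible_choice J A Ci Ca"
    and uv: "u \<in> U J" "v \<in> U J" "T = col_act J v (row_act J u A)" "template T"
    and uv': "u' \<in> U J" "v' \<in> U J" "T' = col_act J v' (row_act J u' A)" "template T'"
    and agree: "\<And>a s. (a, s) \<in> chosen_positions A Ci \<union> y_conditions J (main_conditions A)
      \<Longrightarrow> T $ a $ s = T' $ a $ s"
  shows "T = T'"
proof -
  have tA: "template A" using A(2) by (simp add: normal_template_def)
  have mc: "main_conditions T = main_conditions A" "main_conditions T' = main_conditions A"
    using template_row_changes(1)[OF A(1) tA] uv uv' by auto
  have TV: "T \<in> V J" "T' \<in> V J" using uv(3) uv'(3) by auto
  have "T $ a $ s = T' $ a $ s" for a s
  proof (cases "\<exists>b. (a, b) \<in> main_conditions A")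
    case False
    have "B $ a $ s = 0" if "main_conditions B = main_conditions A" for B :: "('k, 'n) sqmat"
      using False that main_condition_of_nonzero[of B a s] by metis
    then show ?thesis using mc by simp
  next
    case True
    then obtain b where ab: "(a, b) \<in> main_conditions A" by blast
    have val: "col_act J v (row_act J u A) $ a $ b = A $ a $ b"
      if "u \<in> U J" "v \<in> U J" "template (col_act J v (row_act J u A))" for u v
    proof -
      have "(a, b) \<in> main_conditions (row_act J u A)"
        using template_row_changes(1)[OF A(1) tA that] ab main_conditions_col_act[OF that(2) act_in_V(1)] by simp
      then have "\<And>l. b < l \<Longrightarrow> row_act J u A $ a $ l = 0" by (simp add: main_conditions_iff)
      from col_act_beyond[OF that(2) act_in_V(1) this order_refl]
      show ?thesis using template_row_changes(2)[OF A(1) tA that ab] by simp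
    qed
    consider "s \<le> a" | "b < s" | "s = b" | "a < s" "s < b" "\<not> normal_column J s"
      | "a < s" "s < b" "normal_column J s" by force
    then show ?thesis
    proof cases
      case 1
      then have "(a, s) \<notin> J" using J_less by force
      then show ?thesis using V_entry[OF TV(1), of a s] V_entry[OF TV(2), of a s] by force
    next
      case 2
      then show ?thesis using ab mc by (metis main_conditions_iff)
    next
      case 3
      then show ?thesis using val uv uv' by simp
    next
      case 4
      then show ?thesis
        using y_or_intersection[OF A(1) ab 4] agree[of a s] mc
          template_zero_at_intersection[OF uv(4), of a s] template_zero_at_intersection[OF uv'(4), of a s] by auto
    next
      case 5
      let ?R = "R_rows A a b"
      define d where "d e = u $ e $ a - u' $ e $ a" for e
      have diff: "T $ a $ r - T' $ a $ r = (\<Sum>e\<in>?R. d e * A $ e $ r)"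
        if "normal_column J r" "a < r" for r
        using template_normal_entries[OF A(1) tA uv(1,2) uv(4)[unfolded uv(3)] ab that]
          template_normal_entries[OF A(1) tA uv'(1,2) uv'(4)[unfolded uv'(3)] ab that] uv(3) uv'(3)
        by (simp add: d_def left_diff_distrib sum_subtractf)
      have basis: "is_column_basis A ?R (C_norm J A a b) (C_n J A a b \<union> Ci a)"
        and Ci: "Ci a \<subseteq> C_norm J A a b"
        using A(3) ab unfolding admissible_choice_def by blast+
      have zero: "(\<Sum>e\<in>?R. d e * A $ e $ r) = 0" if r: "r \<in> C_n J A a b \<union> Ci a" for r
      proof -
        have "normal_column J r" "a < r" using r Ci by (auto simp: C_n_def C_norm_def C_hat_def)
        moreover have "T $ a $ r = T' $ a $ r"
        proof (cases "r \<in> Ci a")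
          case True
          then show ?thesis using agree[of a r] ab by (auto simp: chosen_positions_def)
        next
          case False
          then have "(a, r) \<in> H_n J A" using r ab by (auto simp: H_n_def)
          then show ?thesis
            using template_vanishes[OF A uv(4) mc(1), of a r] template_vanishes[OF A uv'(4) mc(2), of a r] by simp
        qed
        ultimately show ?thesis using diff[of r] by simp
      qed
      have "(\<Sum>e\<in>?R. d e * A $ e $ s) = 0"
      proof (cases "s \<in> C_hat A a b")
        case True
        then have "s \<in> C_norm J A a b" using 5 by (simp add: C_norm_def)
        then show ?thesis using column_basis_functional_zero[OF basis, of d s] zero by blast
      next
        case False
        then show ?thesis using 5 by (intro sum.neutral) (auto simp: C_hat_def)
      qed
      then show ?thesis using diff[OF 5(3,1)] by simp
    qed
  qed
  then show ?thesis by (simp add: vec_eq_iff)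
qed

text \<open>
  Row operations first produce the required entries at the column basis in every row, since a
  combination of the rows \<open>R_rows A a b\<close> may be prescribed on it; the main conditions survive
  because these rows end left of column \<open>b\<close>.  Then column operations set all nonnormal entries left
  of the main conditions freely: to \<open>\<beta>\<close> at the \<open>y\<close>-conditions and to zero at the intersections.
  The prescribed zeros on \<open>C_n J A a b\<close> are what makes the result vanish at the intersections in
  normal columns, too.
\<close>

lemma template_with_entries:
  fixes A :: "('k::field, 'n) sqmat" and \<beta> :: "'n \<times> 'n \<Rightarrow> 'k"
  assumes A: "A \<in> V J" "normal_template J A" "admissible_choice J A Ci Ca"
    and \<beta>: "\<And>a s. (a, s) \<in> H_n J A \<union> chosen_positions A Ca \<Longrightarrow> \<beta> (a, s) = 0"
  obtains u v where "u \<in> U J" "v \<in> U J" "template (col_act J v (row_act J u A))"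
    "\<forall>(a, s)\<in>H_y J A Ci Ca. col_act J v (row_act J u A) $ a $ s = \<beta> (a, s)"
proof -
  define p where "p = main_conditions A"
  have tA: "template A" using A(2) by (simp add: normal_template_def)
  have "\<exists>w. \<forall>b. (a, b) \<in> p \<longrightarrow> (\<forall>s\<in>C_n J A a b \<union> Ci a.
      (\<Sum>e\<in>R_rows A a b. w e * A $ e $ s) = \<beta> (a, s) - A $ a $ s)" for a
  proof (cases "\<exists>b. (a, b) \<in> p")
    case True
    then obtain b where b: "(a, b) \<in> p" by blast
    then have "is_column_basis A (R_rows A a b) (C_norm J A a b) (C_n J A a b \<union> Ci a)"
      using A(3) unfolding admissible_choice_def p_def by blast
    then obtain w where w: "\<forall>s\<in>C_n J A a b \<union> Ci a.
        (\<Sum>e\<in>R_rows A a b. w e * A $ e $ s) = \<beta> (a, s) - A $ a $ s"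
      by (rule column_basis_functional_exists[where x = "\<lambda>s. \<beta> (a, s) - A $ a $ s"])
    have "b' = b" if "(a, b') \<in> p" for b' using that b main_conditions_unique p_def by metis
    then show ?thesis using w by (intro exI[of _ w]) auto
  qed blast
  then have "\<exists>W. \<forall>a b. (a, b) \<in> p \<longrightarrow> (\<forall>s\<in>C_n J A a b \<union> Ci a.
      (\<Sum>e\<in>R_rows A a b. W a e * A $ e $ s) = \<beta> (a, s) - A $ a $ s)"
    by (intro choice allI)
  then obtain W where W: "\<forall>a b. (a, b) \<in> p \<longrightarrow> (\<forall>s\<in>C_n J A a b \<union> Ci a.
      (\<Sum>e\<in>R_rows A a b. W a e * A $ e $ s) = \<beta> (a, s) - A $ a $ s)"
    by (elim exE)
  define u :: "('k, 'n) sqmat" where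
    "u = (\<chi> e a. if e = a then 1 else if \<exists>b. (a, b) \<in> p \<and> e \<in> R_rows A a b then W a e else 0)"
  have u: "u \<in> U J"
    unfolding U_iff
  proof (intro allI impI)
    fix e a assume "(e, a) \<notin> J"
    then have "e \<notin> R_rows A a b" for b
      using J_row[OF main_conditions_J[OF A(1)]] by (auto simp: R_rows_def)
    then show "u $ e $ a = (if e = a then 1 else 0)" by (simp add: u_def)
  qed
  \<comment> \<open>\<open>A'\<close> has the required entries in the normal columns of the basis; its nonnormal entries are
     irrelevant as long as they lie left of the main conditions.\<close>
  define A' where "A' = row_act J u A"
  have A'V: "A' \<in> V J" by (simp add: A'_def)
  have A'_main: "A' $ a $ s = A $ a $ s + (\<Sum>e\<in>R_rows A a b. W a e * A $ e $ s)"
    if "(a, b) \<in> p" "a < s" for a b s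
  proof -
    have uniq: "b' = b" if "(a, b') \<in> p" for b'
      using that \<open>(a, b) \<in> p\<close> main_conditions_unique p_def by metis
    have "(\<Sum>e\<in>active_rows A a. u $ e $ a * A $ e $ s) = (\<Sum>e\<in>R_rows A a b. u $ e $ a * A $ e $ s)"
      by (rule sum.mono_neutral_right)
        (use R_rows_subset_active[of A a b] uniq in \<open>auto simp: u_def active_rows_def\<close>)
    also have "\<dots> = (\<Sum>e\<in>R_rows A a b. W a e * A $ e $ s)"
      using \<open>(a, b) \<in> p\<close> by (intro sum.cong) (auto simp: u_def R_rows_def)
    finally show ?thesis
      using row_act_active[OF u J_row[OF main_conditions_J[OF A(1)] that(2)], of b A] that(1)
      by (simp add: A'_def p_def)
  qed
  have A'_zero: "A' $ a $ s = 0" if "\<nexists>b. (a, b) \<in> p" for a s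
  proof (cases "(a, s) \<in> J")
    case True
    have "A $ a $ s = 0" using that main_condition_of_nonzero[of A a s] unfolding p_def by metis
    moreover have "(\<Sum>e\<in>active_rows A a. u $ e $ a * A $ e $ s) = 0"
      using that by (intro sum.neutral) (auto simp: u_def active_rows_def)
    ultimately show ?thesis using row_act_active[OF u True, of A] by (simp add: A'_def)
  qed (use V_entry[OF A'V, of a s] in blast)
  have A'_beyond: "A' $ a $ s = A $ a $ s" if "(a, b) \<in> p" "b \<le> s" for a b s
  proof -
    have "a < s" using J_less[OF main_conditions_J[OF A(1)], of a b] that by (simp add: p_def)
    then show ?thesis using A'_main[OF that(1)] R_rows_entry_zero[OF _ that(2), of _ A a] by simp
  qed
  have mcA': "main_conditions A' = p"
  proof -
    have sub: "(a, b) \<in> main_conditions A'" if "(a, b) \<in> p" for a b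
      using A'_beyond[OF that] that by (simp add: p_def main_conditions_iff)
    have "(a, b) \<in> p" if ab: "(a, b) \<in> main_conditions A'" for a b
    proof -
      have "A' $ a $ b \<noteq> 0" using ab by (simp add: main_conditions_iff)
      then obtain b' where b': "(a, b') \<in> p" using A'_zero by blast
      then show ?thesis using main_conditions_unique[OF sub[OF b'] ab] by simp
    qed
    then show ?thesis using sub by auto
  qed
  have A'_solved: "A' $ a $ s = \<beta> (a, s)" if "(a, b) \<in> p" "s \<in> C_n J A a b \<union> Ci a" for a b s
  proof -
    have "Ci a \<subseteq> C_norm J A a b"
      using A(3) that(1) unfolding admissible_choice_def p_def by blast
    then have "a < s" using that(2) by (auto simp: C_n_def C_norm_def C_hat_def)
    then show ?thesis using A'_main[OF that(1)] W that by simp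
  qed
  define T :: "('k, 'n) sqmat" where
    "T = (\<chi> a s. if (a, s) \<in> y_conditions J p then \<beta> (a, s)
      else if (a, s) \<in> main_hook_intersections p then 0 else A' $ a $ s)"
  \<comment> \<open>At an intersection in a normal column the zero in the definition of \<open>T\<close> changes nothing:
     this column belongs to \<open>C_n\<close>, where \<open>A'\<close> already takes the prescribed value zero.\<close>
  have T_normal: "T $ a $ s = A' $ a $ s" if "normal_column J s" for a s
  proof (cases "(a, s) \<in> main_hook_intersections p")
    case True
    then obtain b where ab: "(a, b) \<in> p" by (auto simp: intersection_iff)
    then have Cn: "s \<in> C_n J A a b"
      using intersection_normal_C_n True that by (simp add: p_def)
    then have "(a, s) \<in> H_n J A" using ab by (auto simp: H_n_def p_def)
    then have "A' $ a $ s = 0" using A'_solved[OF ab, of s] Cn \<beta>[of a s] by simp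
    then show ?thesis using True intersection_not_y[OF True] by (simp add: T_def)
  qed (use that y_not_normal in \<open>auto simp: T_def\<close>)
  have TV: "T \<in> V J"
    unfolding V_def using y_arm[of _ _ J p] V_entry[OF A'V] by (auto simp: T_def split: if_splits)
  have "\<not> normal_column J s \<and> (\<exists>b>s. (a, b) \<in> main_conditions A')" if "T $ a $ s \<noteq> A' $ a $ s" for a s
  proof -
    have "(a, s) \<in> y_conditions J p \<or> (a, s) \<in> main_hook_intersections p"
      using that by (auto simp: T_def split: if_splits)
    then have "\<exists>b>s. (a, b) \<in> p" using y_arm[of a s J p] by (auto simp: intersection_iff)
    then show ?thesis using T_normal that mcA' by auto
  qed
  moreover have "inj_on snd (main_conditions A')"
    unfolding mcA' p_def by (rule template_distinct_columns[OF tA A(1)])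
  ultimately obtain v where v: "v \<in> U J" "col_act J v A' = T"
    using col_orbit_all_arms[OF A'V _ TV] by blast
  have mcT: "main_conditions T = p"
    using main_conditions_col_act[OF v(1) A'V] v(2) mcA' by simp
  have "template T"
    unfolding template_def mcT
  proof clarify
    fix i j k assume ij: "(i, j) \<in> p" "i < k" "k < j"
    show "T $ k $ j = 0"
    proof (cases "\<exists>b. (k, b) \<in> p")
      case False
      then have "(k, j) \<notin> y_conditions J p" using y_arm[of k j J p] by blast
      then show ?thesis using A'_zero[OF False] by (simp add: T_def)
    next
      case True
      then obtain b where kb: "(k, b) \<in> p" by blast
      have uniq: "b' = b" if "(k, b') \<in> p" for b' using that kb main_conditions_unique p_def by metis
      have "j \<noteq> b"
        using template_distinct_columns[OF tA A(1)] ij(1,2) kb unfolding p_def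
        by (metis inj_onD less_irrefl prod.inject snd_conv)
      then consider "j < b" | "b < j" by force
      then show ?thesis
      proof cases
        case 1
        then have "(k, j) \<in> main_hook_intersections p" using ij kb by (auto simp: intersection_iff)
        then show ?thesis using intersection_not_y by (auto simp: T_def)
      next
        case 2
        then have "(k, j) \<notin> y_conditions J p" using y_arm[of k j J p] uniq by force
        moreover have "A' $ k $ j = 0"
          using A'_beyond[OF kb, of j] 2 kb by (simp add: p_def main_conditions_iff)
        ultimately show ?thesis by (simp add: T_def)
      qed
    qed
  qed
  moreover have "\<forall>(a, s)\<in>H_y J A Ci Ca. T $ a $ s = \<beta> (a, s)"
  proof clarify
    fix a s assume "(a, s) \<in> H_y J A Ci Ca"
    then consider "(a, s) \<in> y_conditions J p" | b where "(a, b) \<in> p" "s \<in> C_n J A a b \<union> Ci a"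
      | b where "(a, b) \<in> p" "s \<in> Ca a"
      unfolding H_y_def H_n_def chosen_positions_def p_def by blast
    then show "T $ a $ s = \<beta> (a, s)"
    proof cases
      case 1
      then show ?thesis by (simp add: T_def)
    next
      case 2
      have "Ci a \<subseteq> C_norm J A a b"
        using A(3) 2(1) unfolding admissible_choice_def p_def by blast
      then have "normal_column J s" using 2(2) by (auto simp: C_n_def C_norm_def)
      then show ?thesis using T_normal A'_solved[OF 2] by simp
    next
      case 3
      then have "(a, s) \<in> chosen_positions A Ca" by (auto simp: chosen_positions_def p_def)
      moreover from this have "T $ a $ s = 0"
        using template_vanishes[OF A \<open>template T\<close>, of a s] mcT by (simp add: p_def)
      ultimately show ?thesis using \<beta>[of a s] by simp
    qed
  qed
  ultimately show ?thesis using that[OF u v(1)] v(2) by (simp add: A'_def)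
qed

text \<open>
  The four kinds of positions separate: \<open>y\<close>-conditions and \<open>Ca\<close> lie in nonnormal columns, the
  other two in normal ones; \<open>Ca\<close> consists of main hook intersections, which are not
  \<open>y\<close>-conditions, and \<open>Ci\<close> was chosen outside \<open>C_n\<close>.  So an element of
  \<open>I_set\<close> is a free choice on the positions of \<open>Ci\<close> and the \<open>y\<close>-conditions.
\<close>

lemma card_I_set:
  fixes A :: "('k::{field,finite}, 'n) sqmat"
  assumes A: "A \<in> V J" "normal_template J A" "admissible_choice J A Ci Ca"
  shows "card (I_set J A Ci Ca :: ('n \<times> 'n \<Rightarrow> 'k) set)
    = CARD('k) ^ (card (chosen_positions A Ci) + card (y_conditions J (main_conditions A)))"
proof -
  let ?Z = "H_n J A \<union> chosen_positions A Ca"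
  let ?F = "chosen_positions A Ci \<union> y_conditions J (main_conditions A)"
  let ?I = "I_set J A Ci Ca :: ('n \<times> 'n \<Rightarrow> 'k) set"
  have H: "H_y J A Ci Ca = ?Z \<union> ?F" by (auto simp: H_y_def)
  have Ci: "s \<in> C_norm J A a b - C_n J A a b" if "(a, b) \<in> main_conditions A" "s \<in> Ci a" for a b s
    using A(3) that unfolding admissible_choice_def by blast
  have Ca: "(a, s) \<in> main_hook_intersections (main_conditions A) \<and> \<not> normal_column J s"
    if "(a, b) \<in> main_conditions A" "s \<in> Ca a" for a b s
  proof -
    have "s \<in> C_hat A a b - C_norm J A a b"
      using A(3) that unfolding admissible_choice_def by blast
    then show ?thesis using C_hat_not_normal_intersection[OF A(1,2) that(1), of s] by (auto simp: C_norm_def)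
  qed
  have y: "\<not> normal_column J s \<and> (a, s) \<notin> main_hook_intersections (main_conditions A)"
    if "(a, s) \<in> y_conditions J (main_conditions A)" for a s
    using that by (simp add: y_conditions_def)
  have FF: "chosen_positions A Ci \<inter> y_conditions J (main_conditions A) = {}"
    using Ci y by (force simp: chosen_positions_def C_norm_def)
  have ZF: "?Z \<inter> ?F = {}"
  proof -
    have "(a, s) \<notin> ?F" if as: "(a, s) \<in> H_n J A" for a s
    proof -
      obtain b where b: "(a, b) \<in> main_conditions A" "s \<in> C_n J A a b" using as by (auto simp: H_n_def)
      have "s \<notin> Ci a" using Ci[OF b(1)] b(2) by blast
      moreover have "normal_column J s" using b(2) by (simp add: C_n_def C_norm_def)
      ultimately show ?thesis using y by (auto simp: chosen_positions_def)
    qed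
    moreover have "(a, s) \<notin> ?F" if as: "(a, s) \<in> chosen_positions A Ca" for a s
    proof -
      obtain b where b: "(a, b) \<in> main_conditions A" "s \<in> Ca a" using as by (auto simp: chosen_positions_def)
      have "s \<notin> Ci a" using Ci[OF b(1)] Ca[OF b] by (auto simp: C_norm_def)
      then show ?thesis using y Ca[OF b] by (auto simp: chosen_positions_def)
    qed
    ultimately show ?thesis by auto
  qed
  have "bij_betw (\<lambda>\<beta>. restrict \<beta> ?F) ?I (?F \<rightarrow>\<^sub>E UNIV)"
  proof (rule bij_betw_byWitness[where f' = "\<lambda>\<gamma>. \<lambda>q\<in>?Z \<union> ?F. if q \<in> ?F then \<gamma> q else 0"])
    show "\<forall>\<beta>\<in>?I. (\<lambda>q\<in>?Z \<union> ?F. if q \<in> ?F then restrict \<beta> ?F q else 0) = \<beta>"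
    proof (intro ballI ext)
      fix \<beta> q assume "\<beta> \<in> ?I"
      then have "\<beta> \<in> extensional (?Z \<union> ?F)" "\<And>q. q \<in> ?Z \<Longrightarrow> \<beta> q = 0"
        unfolding I_set_def H by (auto simp: PiE_def)
      then show "(\<lambda>q\<in>?Z \<union> ?F. if q \<in> ?F then restrict \<beta> ?F q else 0) q = \<beta> q"
        by (cases q) (auto simp: extensional_def)
    qed
    show "\<forall>\<gamma>\<in>?F \<rightarrow>\<^sub>E (UNIV :: 'k set). restrict (\<lambda>q\<in>?Z \<union> ?F. if q \<in> ?F then \<gamma> q else 0) ?F = \<gamma>"
    proof (intro ballI ext)
      fix \<gamma> :: "'n \<times> 'n \<Rightarrow> 'k" and q assume "\<gamma> \<in> ?F \<rightarrow>\<^sub>E UNIV"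
      then show "restrict (\<lambda>q\<in>?Z \<union> ?F. if q \<in> ?F then \<gamma> q else 0) ?F q = \<gamma> q"
        by (cases q) (auto simp: PiE_def extensional_def)
    qed
    show "(\<lambda>\<beta>. restrict \<beta> ?F) ` ?I \<subseteq> ?F \<rightarrow>\<^sub>E UNIV" by (auto split: if_splits)
    show "(\<lambda>\<gamma>. \<lambda>q\<in>?Z \<union> ?F. if q \<in> ?F then \<gamma> q else 0) ` (?F \<rightarrow>\<^sub>E UNIV) \<subseteq> ?I"
      using ZF unfolding I_set_def H by (auto simp: PiE_def)
  qed
  then have "card ?I = card (?F \<rightarrow>\<^sub>E (UNIV :: 'k set))" by (rule bij_betw_same_card)
  also have "\<dots> = CARD('k) ^ card ?F" by (simp add: card_PiE)
  also have "card ?F = card (chosen_positions A Ci) + card (y_conditions J (main_conditions A))"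
    by (rule card_Un_disjoint) (use FF in auto)
  finally show ?thesis .
qed

end

section \<open>The row orbits inside a biorbit\<close>

abbreviation row_maps :: "('n::finite \<times> 'n) set \<Rightarrow> (('k::field, 'n) sqmat \<Rightarrow> ('k, 'n) sqmat) set" where
  "row_maps J \<equiv> row_act J ` U J"

abbreviation col_maps :: "('n::finite \<times> 'n) set \<Rightarrow> (('k::field, 'n) sqmat \<Rightarrow> ('k, 'n) sqmat) set" where
  "col_maps J \<equiv> col_act J ` U J"

definition biorbit_templates ::
  "('n::{finite,linorder} \<times> 'n) set \<Rightarrow> ('k::field, 'n) sqmat \<Rightarrow> ('k, 'n) sqmat set" where
  "biorbit_templates J A = {T \<in> biorbit (row_maps J) (col_maps J) A. template T}"

context row_closed_pattern
begin

lemma biorbit_templates_cases: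
  fixes A :: "('k::{field,finite}, 'n) sqmat"
  assumes "A \<in> V J" "T \<in> biorbit_templates J A"
  obtains u v where "u \<in> U J" "v \<in> U J" "T = col_act J v (row_act J u A)" "template T"
proof -
  obtain u v where uv: "u \<in> U J" "v \<in> U J" "T = row_act J u (col_act J v A)" "template T"
    using assms(2) unfolding biorbit_templates_def biorbit_def by blast
  show ?thesis by (rule that[OF uv(1,2) _ uv(4)]) (simp add: uv(3) row_act_col_act[OF uv(1,2)])
qed

text \<open>
  Each row orbit in the biorbit contains a template, and no second one.
\<close>

lemma bij_betw_templates_row_orbits:
  fixes A :: "('k::{field,finite}, 'n) sqmat"
  assumes A: "A \<in> V J"
  shows "bij_betw (orbit (row_maps J)) (biorbit_templates J A)
    {orbit (row_maps J) B | B. B \<in> V J \<and> orbit (row_maps J) B \<subseteq> biorbit (row_maps J) (col_maps J) A}"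
proof -
  interpret commuting_actions "V J :: ('k, 'n) sqmat set" "row_maps J" "col_maps J"
    by (rule commuting_actions_U)
  let ?bi = "biorbit (row_maps J) (col_maps J) A" and ?O = "orbit (row_maps J)"
  have biV: "?bi \<subseteq> V J" by (rule biorbit_subset[OF A])
  have sub: "?O B \<subseteq> ?bi" if B: "B \<in> ?bi" for B
  proof -
    obtain y where y: "y \<in> orbit (col_maps J) A" "B \<in> ?O y"
      using B unfolding biorbit_eq_Union by (rule UN_E)
    have "y \<in> V J" using y(1) R.orbit_subset[OF A] by (rule rev_subsetD)
    then have "?O B = ?O y" using y(2) by (rule L.orbit_eq)
    then show ?thesis unfolding biorbit_eq_Union using y(1) by (simp add: UN_upper)
  qed
  show ?thesis
    unfolding bij_betw_def
  proof
    show "inj_on ?O (biorbit_templates J A)"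
    proof (rule inj_onI)
      fix T T' assume T: "T \<in> biorbit_templates J A" "T' \<in> biorbit_templates J A" "?O T = ?O T'"
      then have t: "template T" "template T'" "T \<in> V J" "T' \<in> V J"
        using biV by (auto simp: biorbit_templates_def)
      have "T' \<in> ?O T" using T(3) L.orbit_refl[OF t(4)] by simp
      then obtain u where u: "u \<in> U J" "T' = row_act J u T" by (auto simp: orbit_def)
      then show "T = T'" using template_unique_in_row_orbit[OF t(3,1) u(1)] t(2) by simp
    qed
    show "?O ` biorbit_templates J A = {?O B | B. B \<in> V J \<and> ?O B \<subseteq> ?bi}"
    proof (intro equalityI subsetI)
      fix S assume "S \<in> ?O ` biorbit_templates J A"
      then obtain T where T: "T \<in> ?bi" "S = ?O T" by (auto simp: biorbit_templates_def)
      then show "S \<in> {?O B | B. B \<in> V J \<and> ?O B \<subseteq> ?bi}" using sub biV by blast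
    next
      fix S assume "S \<in> {?O B | B. B \<in> V J \<and> ?O B \<subseteq> ?bi}"
      then obtain B where B: "B \<in> V J" "?O B \<subseteq> ?bi" "S = ?O B" by blast
      obtain u where u: "u \<in> U J" "template (row_act J u B)" by (rule template_in_row_orbit[OF B(1)])
      have T: "row_act J u B \<in> ?O B" using u(1) by (auto simp: orbit_def)
      then have "row_act J u B \<in> biorbit_templates J A" using u(2) B(2) by (auto simp: biorbit_templates_def)
      moreover have "S = ?O (row_act J u B)" using L.orbit_eq[OF B(1) T] B(3) by simp
      ultimately show "S \<in> ?O ` biorbit_templates J A" by blast
    qed
  qed
qed

lemma biorbit_eq_Union_templates:
  fixes A :: "('k::{field,finite}, 'n) sqmat"
  assumes A: "A \<in> V J"
  shows "biorbit (row_maps J) (col_maps J) A = (\<Union>T\<in>biorbit_templates J A. orbit (row_maps J) T)"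
proof -
  interpret commuting_actions "V J :: ('k, 'n) sqmat set" "row_maps J" "col_maps J"
    by (rule commuting_actions_U)
  have "orbit (row_maps J) ` biorbit_templates J A = orbit (row_maps J) ` orbit (col_maps J) A"
    using bij_betw_templates_row_orbits[OF A] orbits_in_biorbit[OF A] by (simp add: bij_betw_def)
  then show ?thesis unfolding biorbit_eq_Union by simp
qed

lemma disjoint_template_orbits:
  fixes A :: "('k::{field,finite}, 'n) sqmat"
  assumes A: "A \<in> V J"
  shows "disjoint_family_on (orbit (row_maps J)) (biorbit_templates J A)"
  unfolding disjoint_family_on_def
proof (intro ballI impI)
  interpret commuting_actions "V J :: ('k, 'n) sqmat set" "row_maps J" "col_maps J"
    by (rule commuting_actions_U)
  fix T T' assume T: "T \<in> biorbit_templates J A" "T' \<in> biorbit_templates J A" "T \<noteq> T'"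
  then have V: "T \<in> V J" "T' \<in> V J" using biorbit_subset[OF A] by (auto simp: biorbit_templates_def)
  have "orbit (row_maps J) T \<noteq> orbit (row_maps J) T'"
    using inj_onD[OF bij_betw_imp_inj_on[OF bij_betw_templates_row_orbits[OF A]] _ T(1,2)] T(3) by blast
  then show "orbit (row_maps J) T \<inter> orbit (row_maps J) T' = {}"
    using L.orbit_eq_or_disjoint[OF V] by blast
qed

text \<open>
  For a template the row orbit and the column orbit have the same size, so the two ways of
  cutting one of them into equal pieces give equally many pieces.
\<close>

lemma card_row_orbits_eq_card_col_orbits:
  fixes A :: "('k::{field,finite}, 'n) sqmat"
  assumes A: "A \<in> V J" "template A"
  defines "m \<equiv> card (orbit (row_maps J) ` orbit (col_maps J) A)"
    and "l \<equiv> orbit (row_maps J) A" and "r \<equiv> orbit (col_maps J) A"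
  shows "card (orbit (col_maps J) ` orbit (row_maps J) A) = m"
    and "real m = real (card r) / real (card (r \<inter> l))"
    and "real m = real (card l) / real (card (r \<inter> l))"
proof -
  interpret commuting_actions "V J :: ('k, 'n) sqmat set" "row_maps J" "col_maps J"
    by (rule commuting_actions_U)
  have r: "card r = m * card (r \<inter> l)"
    unfolding m_def l_def r_def by (rule card_orbit_eq[OF A(1)]) simp
  have l: "card l = card (orbit (col_maps J) ` orbit (row_maps J) A) * card (r \<inter> l)"
    unfolding l_def r_def
    using commuting_actions.card_orbit_eq[OF swapped A(1)] by (simp add: Int_commute)
  have eq: "card r = card l" unfolding l_def r_def by (rule card_col_orbit_eq_card_row_orbit[OF A])
  have "A \<in> r \<inter> l" using L.orbit_refl R.orbit_refl A(1) by (simp add: l_def r_def)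
  then have "card (r \<inter> l) \<noteq> 0" by (auto simp: card_eq_0_iff)
  then show "card (orbit (col_maps J) ` orbit (row_maps J) A) = m"
    "real m = real (card r) / real (card (r \<inter> l))" "real m = real (card l) / real (card (r \<inter> l))"
    using r l eq by simp_all
qed

lemma biorbit_template_exists_unique:
  fixes A :: "('k::{field,finite}, 'n) sqmat"
  assumes A: "A \<in> V J" "normal_template J A" "admissible_choice J A Ci Ca"
    and \<beta>: "\<beta> \<in> I_set J A Ci Ca"
  shows "\<exists>!T. T \<in> biorbit_templates J A \<and> (\<forall>(r, s)\<in>H_y J A Ci Ca. T $ r $ s = \<beta> (r, s))"
proof (rule ex_ex1I)
  have "\<beta> (a, s) = 0" if "(a, s) \<in> H_n J A \<union> chosen_positions A Ca" for a s
    using \<beta> that by (auto simp: I_set_def)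
  then obtain u v where uv: "u \<in> U J" "v \<in> U J" "template (col_act J v (row_act J u A))"
      "\<forall>(a, s)\<in>H_y J A Ci Ca. col_act J v (row_act J u A) $ a $ s = \<beta> (a, s)"
    by (rule template_with_entries[OF A, where \<beta> = \<beta>])
  have "col_act J v (row_act J u A) \<in> biorbit_templates J A"
    using uv(1,2,3) row_act_col_act[OF uv(1,2), of A] unfolding biorbit_templates_def biorbit_def
    by (metis (mono_tags, lifting) imageI mem_Collect_eq)
  then show "\<exists>T. T \<in> biorbit_templates J A \<and> (\<forall>(r, s)\<in>H_y J A Ci Ca. T $ r $ s = \<beta> (r, s))"
    using uv(4) by blast
next
  fix T T' assume T: "T \<in> biorbit_templates J A \<and> (\<forall>(r, s)\<in>H_y J A Ci Ca. T $ r $ s = \<beta> (r, s))"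
    and T': "T' \<in> biorbit_templates J A \<and> (\<forall>(r, s)\<in>H_y J A Ci Ca. T' $ r $ s = \<beta> (r, s))"
  obtain u v where uv: "u \<in> U J" "v \<in> U J" "T = col_act J v (row_act J u A)" "template T"
    using biorbit_templates_cases[OF A(1)] T by blast
  obtain u' v' where uv': "u' \<in> U J" "v' \<in> U J" "T' = col_act J v' (row_act J u' A)" "template T'"
    using biorbit_templates_cases[OF A(1)] T' by blast
  show "T = T'"
  proof (rule template_determined[OF A uv uv'])
    fix a s assume "(a, s) \<in> chosen_positions A Ci \<union> y_conditions J (main_conditions A)"
    then have "(a, s) \<in> H_y J A Ci Ca" by (auto simp: H_y_def)
    then show "T $ a $ s = T' $ a $ s" using T T' by fastforce
  qed
qed

lemma biorbit_template_entries_in_I_set: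
  fixes A :: "('k::{field,finite}, 'n) sqmat"
  assumes A: "A \<in> V J" "normal_template J A" "admissible_choice J A Ci Ca"
    and T: "T \<in> biorbit_templates J A"
  shows "(\<lambda>(r, s)\<in>H_y J A Ci Ca. T $ r $ s) \<in> I_set J A Ci Ca"
proof -
  obtain u v where uv: "u \<in> U J" "v \<in> U J" "T = col_act J v (row_act J u A)" "template T"
    by (rule biorbit_templates_cases[OF A(1) T])
  have "template A" using A(2) by (simp add: normal_template_def)
  then have "main_conditions T = main_conditions A"
    using template_row_changes(1)[OF A(1) _ uv(1,2)] uv(3,4) by simp
  then show ?thesis
    using template_vanishes[OF A uv(4)] by (auto simp: I_set_def H_y_def)
qed

end

section \<open>Orbits of characters as images of orbits of matrices\<close>

text \<open>
  If two characters agree, testing them on multiples of a single matrix unit at a position where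
  the matrices differ forces \<open>\<theta>\<close> to be trivial.
\<close>

lemma lin_char_inj:
  fixes J :: "('n::finite \<times> 'n) set"
  assumes "nontrivial_character (\<theta> :: 'k::field \<Rightarrow> complex)"
  shows "inj_on (lin_char \<theta> J) (V J :: ('k, 'n) sqmat set)"
proof (rule inj_onI, rule ccontr)
  fix A B :: "('k, 'n) sqmat"
  assume AB: "A \<in> V J" "B \<in> V J" "lin_char \<theta> J A = lin_char \<theta> J B" "A \<noteq> B"
  then obtain i j where ij: "A $ i $ j \<noteq> B $ i $ j" by (auto simp: vec_eq_iff)
  then have J: "(i, j) \<in> J" using V_entry[OF AB(1), of i j] V_entry[OF AB(2), of i j] by force
  have add: "\<theta> (x + y) = \<theta> x * \<theta> y" and nz: "\<theta> x \<noteq> 0" for x y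
    using assms by (simp_all add: nontrivial_character_def)
  have "\<theta> x = 1" for x
  proof -
    define c where "c = x / (A $ i $ j - B $ i $ j)"
    define C :: "('k, 'n) sqmat" where "C = (\<chi> r s. if r = i \<and> s = j then c else 0)"
    have C: "C \<in> V J" using J by (auto simp: C_def V_def split: if_splits)
    have sum: "(\<Sum>(r, s)\<in>J. D $ r $ s * C $ r $ s) = D $ i $ j * c" for D :: "('k, 'n) sqmat"
    proof -
      have "(\<Sum>(r, s)\<in>J. D $ r $ s * C $ r $ s) = (\<Sum>q\<in>J. if q = (i, j) then D $ i $ j * c else 0)"
        by (rule sum.cong) (auto simp: C_def split: if_splits)
      then show ?thesis using J by simp
    qed
    have "\<theta> (A $ i $ j * c) = \<theta> (B $ i $ j * c)"
      using fun_cong[OF AB(3), of C] C by (simp add: lin_char_def sum)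
    moreover have "A $ i $ j * c = B $ i $ j * c + x"
      using ij by (simp add: c_def field_simps)
    ultimately show ?thesis using add[of "B $ i $ j * c" x] nz[of "B $ i $ j * c"] by simp
  qed
  then show False using assms by (simp add: nontrivial_character_def)
qed

lemma mat_of_lin_char:
  "nontrivial_character \<theta> \<Longrightarrow> B \<in> V J \<Longrightarrow> mat_of \<theta> J (lin_char \<theta> J B) = B"
  unfolding mat_of_def by (rule the_inv_into_f_f[OF lin_char_inj])

lemma (in row_closed_pattern) act_lin_char:
  fixes u v B :: "('k::{field,finite}, 'n) sqmat"
  assumes "nontrivial_character \<theta>" "B \<in> V J" "u \<in> U J" "v \<in> U J"
  shows "act \<theta> J u (lin_char \<theta> J B) v
    = lin_char \<theta> J (row_act J (matrix_inv u) (col_act J (matrix_inv v) B))"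
  unfolding act_def mat_of_lin_char[OF assms(1,2)] col_act_def row_act_proj[OF matrix_inv_U(1)[OF assms(3)]]
  by (simp add: row_act_def matrix_mul_assoc)

lemma (in row_closed_pattern) orbits_lin_char:
  fixes B :: "('k::{field,finite}, 'n) sqmat"
  assumes "nontrivial_character \<theta>" "B \<in> V J"
  shows "left_orbit \<theta> J (lin_char \<theta> J B) = lin_char \<theta> J ` orbit (row_act J ` U J) B"
    and "right_orbit \<theta> J (lin_char \<theta> J B) = lin_char \<theta> J ` orbit (col_act J ` U J) B"
    and "bi_orbit \<theta> J (lin_char \<theta> J B) = lin_char \<theta> J ` biorbit (row_act J ` U J) (col_act J ` U J) B"
proof -
  have inv: "(matrix_inv :: ('k, 'n) sqmat \<Rightarrow> _) ` U J = U J"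
    using matrix_inv_U by (force simp: image_iff)
  have "\<exists>x'. mat 1 ** x' = (mat 1 :: ('k, 'n) sqmat) \<and> x' ** mat 1 = mat 1" by (intro exI[of _ "mat 1"]) simp
  then have one: "matrix_inv (mat 1 :: ('k, 'n) sqmat) = mat 1"
    unfolding matrix_inv_def by (rule someI2_ex) simp
  note act = act_lin_char[OF assms]
  have "left_orbit \<theta> J (lin_char \<theta> J B) = (\<lambda>u. act \<theta> J u (lin_char \<theta> J B) (mat 1)) ` U J"
    unfolding left_orbit_def by (rule Setcompr_eq_image)
  also have "\<dots> = (\<lambda>u. lin_char \<theta> J (row_act J (matrix_inv u) B)) ` U J"
    by (rule image_cong) (simp_all add: act one act_one assms(2))
  also have "\<dots> = (\<lambda>u. lin_char \<theta> J (row_act J u B)) ` matrix_inv ` U J"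
    by (simp only: image_image)
  finally show "left_orbit \<theta> J (lin_char \<theta> J B) = lin_char \<theta> J ` orbit (row_act J ` U J) B"
    unfolding inv by (simp add: orbit_def image_image)
  have "right_orbit \<theta> J (lin_char \<theta> J B) = (\<lambda>v. act \<theta> J (mat 1) (lin_char \<theta> J B) v) ` U J"
    unfolding right_orbit_def by (rule Setcompr_eq_image)
  also have "\<dots> = (\<lambda>v. lin_char \<theta> J (col_act J (matrix_inv v) B)) ` U J"
    by (rule image_cong) (simp_all add: act one act_one)
  also have "\<dots> = (\<lambda>v. lin_char \<theta> J (col_act J v B)) ` matrix_inv ` U J"
    by (simp only: image_image)
  finally show "right_orbit \<theta> J (lin_char \<theta> J B) = lin_char \<theta> J ` orbit (col_act J ` U J) B"
    unfolding inv by (simp add: orbit_def image_image)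
  show "bi_orbit \<theta> J (lin_char \<theta> J B) = lin_char \<theta> J ` biorbit (row_act J ` U J) (col_act J ` U J) B"
  proof (intro equalityI subsetI)
    fix X assume "X \<in> bi_orbit \<theta> J (lin_char \<theta> J B)"
    then obtain u v where uv: "u \<in> U J" "v \<in> U J" "X = act \<theta> J u (lin_char \<theta> J B) v"
      unfolding bi_orbit_def by blast
    have "row_act J (matrix_inv u) (col_act J (matrix_inv v) B)
        \<in> biorbit (row_act J ` U J) (col_act J ` U J) B"
      unfolding biorbit_def using matrix_inv_U(1)[OF uv(1)] matrix_inv_U(1)[OF uv(2)] by blast
    then show "X \<in> lin_char \<theta> J ` biorbit (row_act J ` U J) (col_act J ` U J) B"
      using uv(3) act[OF uv(1,2)] by simp
  next
    fix X assume "X \<in> lin_char \<theta> J ` biorbit (row_act J ` U J) (col_act J ` U J) B"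
    then obtain u v where uv: "u \<in> U J" "v \<in> U J" "X = lin_char \<theta> J (row_act J u (col_act J v B))"
      unfolding biorbit_def by blast
    then have "X = act \<theta> J (matrix_inv u) (lin_char \<theta> J B) (matrix_inv v)"
      by (simp add: act matrix_inv_U)
    then show "X \<in> bi_orbit \<theta> J (lin_char \<theta> J B)"
      unfolding bi_orbit_def using matrix_inv_U(1)[OF uv(1)] matrix_inv_U(1)[OF uv(2)] by blast
  qed
qed

lemma image_of_cells:
  assumes "\<And>B. B \<in> S \<Longrightarrow> F B \<subseteq> Y' \<longleftrightarrow> f B \<subseteq> Y" "\<And>B. B \<in> S \<Longrightarrow> F B = c ` f B"
  shows "{F B | B. B \<in> S \<and> F B \<subseteq> Y'} = (`) c ` {f B | B. B \<in> S \<and> f B \<subseteq> Y}"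
proof -
  have "{F B | B. B \<in> S \<and> F B \<subseteq> Y'} = F ` {B \<in> S. F B \<subseteq> Y'}" by blast
  also have "{B \<in> S. F B \<subseteq> Y'} = {B \<in> S. f B \<subseteq> Y}" using assms(1) by auto
  also have "F ` {B \<in> S. f B \<subseteq> Y} = (\<lambda>B. c ` f B) ` {B \<in> S. f B \<subseteq> Y}"
    using assms(2) by (intro image_cong) auto
  also have "\<dots> = (`) c ` f ` {B \<in> S. f B \<subseteq> Y}" by (simp only: image_image)
  also have "f ` {B \<in> S. f B \<subseteq> Y} = {f B | B. B \<in> S \<and> f B \<subseteq> Y}" by blast
  finally show ?thesis .
qed

section \<open>Parametrization of the left orbits by entries\<close>

theorem theorem7p9:
  fixes \<theta> :: "'k::{field,finite} \<Rightarrow> complex"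
    and J :: "('n::{finite,linorder} \<times> 'n) set"
    and A :: "('k, 'n) sqmat"
    and Ci Ca :: "'n \<Rightarrow> 'n set"
  assumes "nontrivial_character \<theta>"
    and "row_closed J"
    and "A \<in> V J"
    and "normal_template J A"
    and "admissible_choice J A Ci Ca"
  shows "(\<forall>\<beta>\<in>I_set J A Ci Ca.
            \<exists>!X. X \<in> templates_in \<theta> J A \<and> matches_on \<theta> J (H_y J A Ci Ca) X \<beta>)
    \<and> bi_orbit \<theta> J (lin_char \<theta> J A) = (\<Union>X\<in>templates_in \<theta> J A. left_orbit \<theta> J X)
    \<and> disjoint_family_on (left_orbit \<theta> J) (templates_in \<theta> J A)
    \<and> bi_orbit \<theta> J (lin_char \<theta> J A)
        = (\<Union>\<beta>\<in>I_set J A Ci Ca. left_orbit \<theta> J (T_of \<theta> J A Ci Ca \<beta>))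
    \<and> disjoint_family_on (\<lambda>\<beta>. left_orbit \<theta> J (T_of \<theta> J A Ci Ca \<beta>)) (I_set J A Ci Ca)
    \<and> bij_betw (\<lambda>\<beta>. left_orbit \<theta> J (T_of \<theta> J A Ci Ca \<beta>)) (I_set J A Ci Ca)
        (left_orbits_in \<theta> J (bi_orbit \<theta> J (lin_char \<theta> J A)))
    \<and> card (I_set J A Ci Ca)
        = CARD('k) ^ (card (chosen_positions A Ci) + card (y_conditions J (main_conditions A)))
    \<and> real (card (I_set J A Ci Ca))
        = real (card (right_orbit \<theta> J (lin_char \<theta> J A)))
          / real (card (right_orbit \<theta> J (lin_char \<theta> J A) \<inter> left_orbit \<theta> J (lin_char \<theta> J A)))
    \<and> real (card (I_set J A Ci Ca))
        = real (card (left_orbit \<theta> J (lin_char \<theta> J A)))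
          / real (card (right_orbit \<theta> J (lin_char \<theta> J A) \<inter> left_orbit \<theta> J (lin_char \<theta> J A)))
    \<and> card (I_set J A Ci Ca)
        = card (left_orbits_in \<theta> J (bi_orbit \<theta> J (lin_char \<theta> J A)))
    \<and> card (I_set J A Ci Ca)
        = card (right_orbits_in \<theta> J (bi_orbit \<theta> J (lin_char \<theta> J A)))"
proof -
  interpret row_closed_pattern J by unfold_locales (rule assms(2))
  interpret commuting_actions "V J :: ('k, 'n) sqmat set" "row_maps J" "col_maps J"
    by (rule commuting_actions_U)
  note A = assms(3-5)
  have tA: "template A" using A(2) by (simp add: normal_template_def)
  let ?c = "lin_char \<theta> J :: ('k, 'n) sqmat \<Rightarrow> _"
  let ?I = "I_set J A Ci Ca :: ('n \<times> 'n \<Rightarrow> 'k) set" and ?H = "H_y J A Ci Ca"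
  let ?bi = "biorbit (row_maps J) (col_maps J) A" and ?TM = "biorbit_templates J A"
  let ?l = "orbit (row_maps J)" and ?r = "orbit (col_maps J)"
  let ?LO = "\<lambda>\<beta>. left_orbit \<theta> J (T_of \<theta> J A Ci Ca \<beta>)"
  let ?cells = "{?l B | B. B \<in> V J \<and> ?l B \<subseteq> ?bi}"
  have inj: "inj_on ?c (V J)" by (rule lin_char_inj[OF assms(1)])
  have biV: "?bi \<subseteq> V J" by (rule biorbit_subset[OF A(1)])
  have TMV: "?TM \<subseteq> V J" using biV by (auto simp: biorbit_templates_def)
  note mat = mat_of_lin_char[OF assms(1)]
  note left = orbits_lin_char(1)[OF assms(1)] and right = orbits_lin_char(2)[OF assms(1)]
  have bi: "bi_orbit \<theta> J (?c A) = ?c ` ?bi" by (rule orbits_lin_char(3)[OF assms(1) A(1)])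
  have "template (mat_of \<theta> J (?c T)) \<longleftrightarrow> template T" if "T \<in> ?bi" for T
    using mat[of T J] biV that by auto
  then have temp: "templates_in \<theta> J A = ?c ` ?TM"
    unfolding templates_in_def bi biorbit_templates_def by auto
  have matches: "matches_on \<theta> J ?H (?c T) \<beta> \<longleftrightarrow> (\<forall>(r, s)\<in>?H. T $ r $ s = \<beta> (r, s))" if T: "T \<in> ?TM" for T \<beta>
    unfolding matches_on_def mat[OF subsetD[OF TMV T]] ..
  \<comment> \<open>\<open>TB \<beta>\<close> is the matrix of the character \<open>[T(\<beta>)]\<close>.\<close>
  have "\<exists>TB. \<forall>\<beta>. \<beta> \<in> ?I \<longrightarrow> TB \<beta> \<in> ?TM \<and> (\<forall>(r, s)\<in>?H. TB \<beta> $ r $ s = \<beta> (r, s))"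
    by (rule choice) (use biorbit_template_exists_unique[OF A] in blast)
  then obtain TB where TB: "\<And>\<beta>. \<beta> \<in> ?I \<Longrightarrow> TB \<beta> \<in> ?TM"
      "\<And>\<beta>. \<beta> \<in> ?I \<Longrightarrow> \<forall>(r, s)\<in>?H. TB \<beta> $ r $ s = \<beta> (r, s)" by blast
  have TB_unique: "T = TB \<beta>" if "\<beta> \<in> ?I" "T \<in> ?TM" "\<forall>(r, s)\<in>?H. T $ r $ s = \<beta> (r, s)" for \<beta> T
    using biorbit_template_exists_unique[OF A that(1)] TB[OF that(1)] that(2,3) by blast
  have param: "X \<in> templates_in \<theta> J A \<and> matches_on \<theta> J ?H X \<beta> \<longleftrightarrow> X = ?c (TB \<beta>)" if "\<beta> \<in> ?I" for \<beta> X
    unfolding temp using matches TB[OF that] TB_unique[OF that] by blast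
  have T_of: "T_of \<theta> J A Ci Ca \<beta> = ?c (TB \<beta>)" if "\<beta> \<in> ?I" for \<beta>
    unfolding T_of_def param[OF that] by simp
  have LO: "?LO \<beta> = ?c ` ?l (TB \<beta>)" if "\<beta> \<in> ?I" for \<beta>
    unfolding T_of[OF that] using left TB(1)[OF that] TMV by blast
  have bij_TB: "bij_betw TB ?I ?TM"
    unfolding bij_betw_def
  proof
    show "inj_on TB ?I"
    proof (rule inj_onI, rule ext)
      fix \<beta> \<beta>' q assume b: "\<beta> \<in> ?I" "\<beta>' \<in> ?I" "TB \<beta> = TB \<beta>'"
      show "\<beta> q = \<beta>' q"
      proof (cases "q \<in> ?H")
        case True
        then show ?thesis using TB(2)[OF b(1)] TB(2)[OF b(2)] b(3) by (cases q) fastforce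
      next
        case False
        then show ?thesis using b(1,2) by (cases q) (auto simp: I_set_def PiE_def extensional_def)
      qed
    qed
    show "TB ` ?I = ?TM"
    proof (intro equalityI subsetI)
      fix T assume T: "T \<in> ?TM"
      have "T = TB (\<lambda>(r, s)\<in>?H. T $ r $ s)"
        by (rule TB_unique[OF biorbit_template_entries_in_I_set[OF A T] T]) auto
      then show "T \<in> TB ` ?I" using biorbit_template_entries_in_I_set[OF A T] by blast
    qed (use TB(1) in blast)
  qed
  have left_cells: "left_orbits_in \<theta> J (bi_orbit \<theta> J (?c A)) = (`) ?c ` ?cells"
  proof -
    have "left_orbit \<theta> J (?c B) \<subseteq> ?c ` ?bi \<longleftrightarrow> ?l B \<subseteq> ?bi" if "B \<in> V J" for B
      unfolding left[OF that] by (rule inj_on_image_subset_iff[OF inj L.orbit_subset[OF that] biV])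
    then show ?thesis unfolding left_orbits_in_def bi using left by (intro image_of_cells)
  qed
  have right_cells: "right_orbits_in \<theta> J (bi_orbit \<theta> J (?c A)) = (`) ?c ` {?r B | B. B \<in> V J \<and> ?r B \<subseteq> ?bi}"
  proof -
    have "right_orbit \<theta> J (?c B) \<subseteq> ?c ` ?bi \<longleftrightarrow> ?r B \<subseteq> ?bi" if "B \<in> V J" for B
      unfolding right[OF that] by (rule inj_on_image_subset_iff[OF inj R.orbit_subset[OF that] biV])
    then show ?thesis unfolding right_orbits_in_def bi using right by (intro image_of_cells)
  qed
  have bij_cells: "bij_betw ?LO ?I (left_orbits_in \<theta> J (bi_orbit \<theta> J (?c A)))"
  proof -
    have "bij_betw (\<lambda>S. ?c ` S) ?cells ((`) ?c ` ?cells)"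
      using inj_on_subset[OF inj_on_image_Pow[OF inj], of ?cells] L.orbit_subset
      by (auto simp: bij_betw_def)
    from bij_betw_trans[OF bij_betw_trans[OF bij_TB bij_betw_templates_row_orbits[OF A(1)]] this]
    show ?thesis unfolding left_cells using LO by (subst bij_betw_cong) (auto simp: o_def)
  qed
  have cells: "?cells = ?l ` ?r A" by (rule orbits_in_biorbit[OF A(1)])
  have cardI: "card ?I = card (?l ` ?r A)"
    using bij_betw_same_card[OF bij_betw_trans[OF bij_TB bij_betw_templates_row_orbits[OF A(1)]]] cells by simp
  have right_card: "card (right_orbits_in \<theta> J (bi_orbit \<theta> J (?c A))) = card (?r ` ?l A)"
  proof -
    have "{?r B | B. B \<in> V J \<and> ?r B \<subseteq> ?bi} = ?r ` ?l A"
      using commuting_actions.orbits_in_biorbit[OF swapped A(1)] biorbit_swapped[OF A(1)] by simp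
    moreover have "inj_on ((`) ?c) {?r B | B. B \<in> V J \<and> ?r B \<subseteq> ?bi}"
      by (rule inj_on_subset[OF inj_on_image_Pow[OF inj]]) (use R.orbit_subset in auto)
    ultimately show ?thesis unfolding right_cells by (simp add: card_image)
  qed
  have orbV: "?l A \<subseteq> V J" "?r A \<subseteq> V J" using L.orbit_subset R.orbit_subset A(1) by auto
  have sizes: "card (left_orbit \<theta> J (?c A)) = card (?l A)" "card (right_orbit \<theta> J (?c A)) = card (?r A)"
    "card (right_orbit \<theta> J (?c A) \<inter> left_orbit \<theta> J (?c A)) = card (?r A \<inter> ?l A)"
    unfolding left[OF A(1)] right[OF A(1)] inj_on_image_Int[OF inj orbV(2,1), symmetric]
    using orbV by (auto intro!: card_image inj_on_subset[OF inj])
  note counts = card_row_orbits_eq_card_col_orbits[OF A(1) tA]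
  have disj: "disjoint_family_on (\<lambda>T. ?c ` ?l T) ?TM"
    unfolding disjoint_family_on_def
  proof (intro ballI impI)
    fix T T' assume T: "T \<in> ?TM" "T' \<in> ?TM" "T \<noteq> T'"
    then have "?l T \<inter> ?l T' = {}"
      using disjoint_template_orbits[OF A(1)] by (auto simp: disjoint_family_on_def)
    then show "?c ` ?l T \<inter> ?c ` ?l T' = {}"
      using inj_on_image_Int[OF inj, of "?l T" "?l T'"] L.orbit_subset T TMV by blast
  qed
  have left_TM: "left_orbit \<theta> J (?c T) = ?c ` ?l T" if "T \<in> ?TM" for T
    using left TMV that by blast
  have biU: "bi_orbit \<theta> J (?c A) = (\<Union>T\<in>?TM. ?c ` ?l T)"
    unfolding bi biorbit_eq_Union_templates[OF A(1)] by blast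
  show ?thesis
  proof (intro conjI)
    show "\<forall>\<beta>\<in>?I. \<exists>!X. X \<in> templates_in \<theta> J A \<and> matches_on \<theta> J ?H X \<beta>"
      using param by simp
    show "bi_orbit \<theta> J (?c A) = (\<Union>X\<in>templates_in \<theta> J A. left_orbit \<theta> J X)"
      unfolding biU temp using left_TM by auto
    show "disjoint_family_on (left_orbit \<theta> J) (templates_in \<theta> J A)"
      unfolding temp disjoint_family_on_def
    proof (intro ballI impI)
      fix X X' assume "X \<in> ?c ` ?TM" "X' \<in> ?c ` ?TM" "X \<noteq> X'"
      then obtain T T' where T: "T \<in> ?TM" "T' \<in> ?TM" "T \<noteq> T'" "X = ?c T" "X' = ?c T'" by blast
      show "left_orbit \<theta> J X \<inter> left_orbit \<theta> J X' = {}"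
        unfolding T(4,5) left_TM[OF T(1)] left_TM[OF T(2)]
        by (rule disjoint_family_onD[OF disj T(1,2,3)])
    qed
    show "bi_orbit \<theta> J (?c A) = (\<Union>\<beta>\<in>?I. ?LO \<beta>)"
      unfolding biU bij_betw_imp_surj_on[OF bij_TB, symmetric] by (simp add: LO)
    show "disjoint_family_on ?LO ?I"
      unfolding disjoint_family_on_def
    proof (intro ballI impI)
      fix \<beta> \<beta>' assume b: "\<beta> \<in> ?I" "\<beta>' \<in> ?I" "\<beta> \<noteq> \<beta>'"
      then have "TB \<beta> \<noteq> TB \<beta>'" using bij_TB by (auto simp: bij_betw_def inj_on_def)
      then show "?LO \<beta> \<inter> ?LO \<beta>' = {}"
        using disj TB(1) b unfolding LO[OF b(1)] LO[OF b(2)] disjoint_family_on_def by blast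
    qed
    show "bij_betw ?LO ?I (left_orbits_in \<theta> J (bi_orbit \<theta> J (?c A)))" by (rule bij_cells)
    show "card ?I = CARD('k) ^ (card (chosen_positions A Ci) + card (y_conditions J (main_conditions A)))"
      by (rule card_I_set[OF A])
    show "real (card ?I) = real (card (right_orbit \<theta> J (?c A)))
        / real (card (right_orbit \<theta> J (?c A) \<inter> left_orbit \<theta> J (?c A)))"
      unfolding sizes cardI by (rule counts(2))
    show "real (card ?I) = real (card (left_orbit \<theta> J (?c A)))
        / real (card (right_orbit \<theta> J (?c A) \<inter> left_orbit \<theta> J (?c A)))"
      unfolding sizes cardI by (rule counts(3))
    show "card ?I = card (left_orbits_in \<theta> J (bi_orbit \<theta> J (?c A)))"
      by (rule bij_betw_same_card[OF bij_cells])
    show "card ?I = card (right_orbits_in \<theta> J (bi_orbit \<theta> J (?c A)))"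
      unfolding right_card cardI by (rule counts(1)[symmetric])
  qed
qed

end
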